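(* Let $n\ge 2$ and let $\mathcal H=\mathcal H_1\otimes\cdots\otimes\mathcal H_n$ be an $n$-partite quantum system with finite local dimensions $\dim\mathcal H_i\ge 2$. Let $\mathcal G$ be the geometric mean of bipartite concurrences (GBC) on the states of $\mathcal H$, defined for pure states as the geometric mean, over all bipartitions of the $n$ parties, of the regularized bipartite concurrences, and for mixed states by the convex roof. Then $\mathcal G$ is a genuine multipartite entanglement (GME) measure, that is: \begin{enumerate} \item (entanglement monotone) $\mathcal G$ does not increase on average under LOCC: for every state $\rho$ on $\mathcal H$ and every ensemble $\{p_i,\sigma_i\}$ of states on $\mathcal H$ produced from $\rho$ by an LOCC operation, $\mathcal G(\rho)\ge\sum_i p_i\,\mathcal G(\sigma_i)$; \item $\mathcal G(\rho)=0$ for every biseparable state $\rho$ on $\mathcal H$; \item $\mathcal G(\rho)>0$ for every genuinely entangled state $\rho$ on $\mathcal H$. \end{enumerate}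
   Context: States are density operators on $\mathcal H$; pure states are unit vectors $|\psi\rangle$, identified with $|\psi\rangle\langle\psi|$. Bipartitions. A bipartition $\{A|B\}$ is an unordered partition of the set of parties $\{1,\dots,n\}$ into two nonempty complementary subsets $A,B$. Let $\alpha$ be the set of all bipartitions and $c(\alpha)$ its cardinality, so $c(\alpha)=\sum_{m=1}^{(n-1)/2}\binom nm$ if $n$ is odd and $c(\alpha)=\sum_{m=1}^{(n-2)/2}\binom nm+\frac12\binom n{n/2}$ if $n$ is even (in both cases $2^{n-1}-1$). Regularized bipartite concurrence. For a pure state $|\psi\rangle$ and a bipartition $\{A|B\}$, $$\mathcal C_{AB}(|\psi\rangle)=\sqrt{\frac{d_{\min}}{d_{\min}-1}\bigl(1-\mathrm{tr}(\rho_A^2)\bigr)},\qquad \rho_A=\mathrm{tr}_B(|\psi\rangle\langle\psi|),$$ where $d_{\min}=\min(d_A,d_B)$, with $d_A=\prod_{i\in A}\dim\mathcal H_i$ and $d_B=\prod_{i\in B}\dim\mathcal H_i$. GBC. For a pure state, $$\mathcal G(|\psi\rangle)=\Bigl(\prod_{\{A|B\}\in\alpha}\mathcal C_{AB}(|\psi\rangle)\Bigr)^{1/c(\alpha)}.$$ For a mixed state, $\mathcal G(\rho)=\min\sum_i p_i\,\mathcal G(|\psi_i\rangle)$, the minimum being over all ensemble realizations $\rho=\sum_i p_i|\psi_i\rangle\langle\psi_i|$ with $p_i\ge0$, $\sum_i p_i=1$. Biseparable and genuinely entangled states. A pure state is biseparable if it is a product state with respect to some bipartition of the parties. A mixed state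 is biseparable if it is a convex combination of biseparable pure states (possibly with respect to different bipartitions). A state is genuinely entangled if it is not biseparable. LOCC. An LOCC operation is a quantum instrument implemented by finitely many rounds of local quantum operations (each acting on one party's system) and classical communication of the outcomes among the parties. The ensemble $\{p_i,\sigma_i\}$ it produces from $\rho$ consists of the probabilities $p_i$ of the classical outcomes and the corresponding post-operation states $\sigma_i$, so the overall channel satisfies $\Phi_{\mathrm{LOCC}}(\rho)=\sum_i p_i\sigma_i$. The output states live on the same Hilbert space $\mathcal H$ (same local dimensions) as the input. *)

theory Defs
  imports "HOL-Analysis.Analysis"
begin

text \<open>
  Party \<open>i\<close> has local space \<open>\<complex>\<^bsup>d i\<^esup>\<close>. For a finite set \<open>S\<close> of parties, vectors of
  \<open>\<Otimes>i\<in>S. \<complex>\<^bsup>d i\<^esup>\<close> are given by their coordinates in the product basis, which is indexed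
  by the multi-indices in \<open>basis d S\<close>, and operators by their matrix entries. Coordinates and
  entries vanish off the index set, so that equality of functions is equality of vectors
  and operators.
\<close>

type_synonym mindex = "nat \<Rightarrow> nat"
type_synonym vect = "mindex \<Rightarrow> complex"
type_synonym oper = "mindex \<Rightarrow> mindex \<Rightarrow> complex"

definition basis :: "(nat \<Rightarrow> nat) \<Rightarrow> nat set \<Rightarrow> mindex set" where
  "basis d S = (\<Pi>\<^sub>E i\<in>S. {..<d i})"

definition tdim :: "(nat \<Rightarrow> nat) \<Rightarrow> nat set \<Rightarrow> nat" where
  "tdim d S = (\<Prod>i\<in>S. d i)"

definition op_trace :: "(nat \<Rightarrow> nat) \<Rightarrow> nat set \<Rightarrow> oper \<Rightarrow> complex" where
  "op_trace d S T = (\<Sum>x\<in>basis d S. T x x)"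

definition op_mult :: "(nat \<Rightarrow> nat) \<Rightarrow> nat set \<Rightarrow> oper \<Rightarrow> oper \<Rightarrow> oper" where
  "op_mult d S T U = (\<lambda>x y. \<Sum>z\<in>basis d S. T x z * U z y)"

definition ket_bra :: "vect \<Rightarrow> oper" where
  "ket_bra \<psi> = (\<lambda>x y. \<psi> x * cnj (\<psi> y))"

definition pure_state :: "(nat \<Rightarrow> nat) \<Rightarrow> nat set \<Rightarrow> vect \<Rightarrow> bool" where
  "pure_state d S \<psi> \<longleftrightarrow>
     (\<forall>x. x \<notin> basis d S \<longrightarrow> \<psi> x = 0) \<and> (\<Sum>x\<in>basis d S. (cmod (\<psi> x))\<^sup>2) = 1"

definition density_op :: "(nat \<Rightarrow> nat) \<Rightarrow> nat set \<Rightarrow> oper \<Rightarrow> bool" where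
  "density_op d S \<rho> \<longleftrightarrow>
     (\<forall>x y. x \<notin> basis d S \<or> y \<notin> basis d S \<longrightarrow> \<rho> x y = 0) \<and>
     (\<forall>v. (\<Sum>x\<in>basis d S. \<Sum>y\<in>basis d S. cnj (v x) * \<rho> x y * v y) \<in> \<real>\<^sub>\<ge>\<^sub>0) \<and>
     op_trace d S \<rho> = 1"

text \<open>Partial trace over the parties in \<open>B\<close>, for disjoint \<open>A\<close> and \<open>B\<close>.\<close>

definition ptrace :: "(nat \<Rightarrow> nat) \<Rightarrow> nat set \<Rightarrow> nat set \<Rightarrow> oper \<Rightarrow> oper" where
  "ptrace d A B \<rho> = (\<lambda>x y. if x \<in> basis d A \<and> y \<in> basis d A
     then \<Sum>z\<in>basis d B. \<rho> (merge A B (x, z)) (merge A B (y, z)) else 0)"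

definition tensor :: "(nat \<Rightarrow> nat) \<Rightarrow> nat set \<Rightarrow> nat set \<Rightarrow> vect \<Rightarrow> vect \<Rightarrow> vect" where
  "tensor d A B \<phi> \<eta> = (\<lambda>x. if x \<in> basis d (A \<union> B)
     then \<phi> (restrict x A) * \<eta> (restrict x B) else 0)"

definition bipartitions :: "nat \<Rightarrow> nat set set set" where
  "bipartitions n = {P. partition_on {1..n} P \<and> card P = 2}"

definition concurrence :: "(nat \<Rightarrow> nat) \<Rightarrow> nat set \<Rightarrow> nat set \<Rightarrow> vect \<Rightarrow> real" where
  "concurrence d A B \<psi> =
     (let dmin = real (min (tdim d A) (tdim d B));
          \<rho>A = ptrace d A B (ket_bra \<psi>)
      in sqrt (dmin / (dmin - 1) * (1 - Re (op_trace d A (op_mult d A \<rho>A \<rho>A)))))"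

text \<open>
  The concurrence does not depend on which block of the unordered bipartition \<open>P\<close> is
  called \<open>A\<close>; see \<open>bip_concurrence_eq\<close> below.
\<close>

definition bip_concurrence :: "nat \<Rightarrow> (nat \<Rightarrow> nat) \<Rightarrow> nat set set \<Rightarrow> vect \<Rightarrow> real" where
  "bip_concurrence n d P \<psi> = (let A = (SOME A. A \<in> P) in concurrence d A ({1..n} - A) \<psi>)"

definition gbc_pure :: "nat \<Rightarrow> (nat \<Rightarrow> nat) \<Rightarrow> vect \<Rightarrow> real" where
  "gbc_pure n d \<psi> =
     (\<Prod>P\<in>bipartitions n. bip_concurrence n d P \<psi>) powr (1 / real (card (bipartitions n)))"

definition realizes ::
  "(nat \<Rightarrow> nat) \<Rightarrow> nat set \<Rightarrow> oper \<Rightarrow> nat \<Rightarrow> (nat \<Rightarrow> real) \<Rightarrow> (nat \<Rightarrow> vect) \<Rightarrow> bool" where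
  "realizes d S \<rho> m p \<psi> \<longleftrightarrow>
     (\<forall>i<m. 0 \<le> p i \<and> pure_state d S (\<psi> i)) \<and> (\<Sum>i<m. p i) = 1 \<and>
     \<rho> = (\<lambda>x y. \<Sum>i<m. of_real (p i) * ket_bra (\<psi> i) x y)"

definition gbc :: "nat \<Rightarrow> (nat \<Rightarrow> nat) \<Rightarrow> oper \<Rightarrow> real" where
  "gbc n d \<rho> =
     (LEAST g. \<exists>m p \<psi>. realizes d {1..n} \<rho> m p \<psi> \<and> g = (\<Sum>i<m. p i * gbc_pure n d (\<psi> i)))"

definition biseparable_pure :: "nat \<Rightarrow> (nat \<Rightarrow> nat) \<Rightarrow> vect \<Rightarrow> bool" where
  "biseparable_pure n d \<psi> \<longleftrightarrow>
     (\<exists>A B \<phi> \<eta>. {A, B} \<in> bipartitions n \<and> pure_state d A \<phi> \<and> pure_state d B \<eta> \<and>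
        \<psi> = tensor d A B \<phi> \<eta>)"

definition biseparable :: "nat \<Rightarrow> (nat \<Rightarrow> nat) \<Rightarrow> oper \<Rightarrow> bool" where
  "biseparable n d \<rho> \<longleftrightarrow>
     (\<exists>m p \<psi>. realizes d {1..n} \<rho> m p \<psi> \<and> (\<forall>i<m. biseparable_pure n d (\<psi> i)))"

definition genuinely_entangled :: "nat \<Rightarrow> (nat \<Rightarrow> nat) \<Rightarrow> oper \<Rightarrow> bool" where
  "genuinely_entangled n d \<rho> \<longleftrightarrow> density_op d {1..n} \<rho> \<and> \<not> biseparable n d \<rho>"

text \<open>
  The map \<open>\<rho> \<mapsto> \<Sum>j<r. (K j)\<^sub>i \<rho> ((K j)\<^sub>i)\<^sup>*\<close>, where \<open>(K j)\<^sub>i\<close> applies the \<open>e \<times> d i\<close> matrix \<open>K j\<close>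
  to party \<open>i\<close> and the identity to all others. The output has local dimensions \<open>d(i := e)\<close>.
\<close>

definition local_op ::
  "(nat \<Rightarrow> nat) \<Rightarrow> nat set \<Rightarrow> nat \<Rightarrow> nat \<Rightarrow> nat \<Rightarrow> (nat \<Rightarrow> nat \<Rightarrow> nat \<Rightarrow> complex) \<Rightarrow> oper \<Rightarrow> oper"
where
  "local_op d S i e r K \<rho> =
     (\<lambda>x y. if x \<in> basis (d(i := e)) S \<and> y \<in> basis (d(i := e)) S
        then \<Sum>j<r. \<Sum>a<d i. \<Sum>b<d i.
               K j (x i) a * \<rho> (x(i := a)) (y(i := b)) * cnj (K j (y i) b)
        else 0)"

text \<open>
  Kraus data of an instrument on a single system of dimension \<open>D\<close>: outcome \<open>k \<in> M\<close> has output
  dimension \<open>e k\<close> and Kraus operators \<open>K k 0, \<dots>, K k (r k - 1)\<close>, and the sum over all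
  outcomes is trace preserving.
\<close>

definition kraus_instrument ::
  "nat \<Rightarrow> nat set \<Rightarrow> (nat \<Rightarrow> nat) \<Rightarrow> (nat \<Rightarrow> nat) \<Rightarrow> (nat \<Rightarrow> nat \<Rightarrow> nat \<Rightarrow> nat \<Rightarrow> complex) \<Rightarrow> bool"
where
  "kraus_instrument D M e r K \<longleftrightarrow> finite M \<and>
     (\<forall>a<D. \<forall>b<D. (\<Sum>k\<in>M. \<Sum>j<r k. \<Sum>c<e k. cnj (K k j c a) * K k j c b) =
        (if a = b then 1 else 0))"

text \<open>
  \<open>locc S d d' M \<E>\<close>: the maps \<open>\<E> m\<close>, \<open>m \<in> M\<close>, form an LOCC instrument from local dimensions
  \<open>d\<close> to local dimensions \<open>d'\<close>. In a round one party \<open>i\<close> applies a local instrument and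
  announces the outcome \<open>k\<close>, on which the remaining protocol \<open>\<F> k\<close> may depend; intermediate
  local dimensions are arbitrary (local ancillas). The function \<open>f\<close> names the outcomes of the
  composite protocol; it need not be injective, so classical information may be discarded.
\<close>

inductive locc ::
  "nat set \<Rightarrow> (nat \<Rightarrow> nat) \<Rightarrow> (nat \<Rightarrow> nat) \<Rightarrow> nat set \<Rightarrow> (nat \<Rightarrow> oper \<Rightarrow> oper) \<Rightarrow> bool"
  for S :: "nat set"
where
  locc_stop: "locc S d d {0} (\<lambda>m \<rho>. \<rho>)"
| locc_round:
    "\<lbrakk>i \<in> S; kraus_instrument (d i) M e r K;
      \<And>k. k \<in> M \<Longrightarrow> locc S (d(i := e k)) d' (L k) (\<F> k)\<rbrakk>
     \<Longrightarrow> locc S d d' {f k l | k l. k \<in> M \<and> l \<in> L k}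
           (\<lambda>m \<rho> x y. \<Sum>k\<in>M. \<Sum>l | l \<in> L k \<and> f k l = m.
              \<F> k l (local_op d S i (e k) (r k) (K k) \<rho>) x y)"

text \<open>
  Taking traces in \<open>\<E> m \<rho> = p m \<cdot> \<sigma> m\<close> shows that \<open>p m\<close> is the probability of outcome \<open>m\<close>;
  outcomes of probability zero carry an arbitrary state.
\<close>

definition locc_ensemble ::
  "nat \<Rightarrow> (nat \<Rightarrow> nat) \<Rightarrow> oper \<Rightarrow> nat set \<Rightarrow> (nat \<Rightarrow> real) \<Rightarrow> (nat \<Rightarrow> oper) \<Rightarrow> bool" where
  "locc_ensemble n d \<rho> M p \<sigma> \<longleftrightarrow>
     (\<exists>\<E>. locc {1..n} d d M \<E> \<and>
        (\<forall>m\<in>M. density_op d {1..n} (\<sigma> m) \<and> \<E> m \<rho> = (\<lambda>x y. of_real (p m) * \<sigma> m x y)))"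

lemma concurrence_commute:
  assumes "A \<inter> B = {}"
  shows "concurrence d A B \<psi> = concurrence d B A \<psi>"
proof -
  define g where "g = (\<lambda>x z. \<psi> (merge A B (x, z)))"
  have m: "merge B A (z, x) = merge A B (x, z)" for x z
    using assms by (auto simp: merge_def fun_eq_iff)
  have l: "op_trace d A (op_mult d A (ptrace d A B (ket_bra \<psi>)) (ptrace d A B (ket_bra \<psi>))) =
      (\<Sum>x\<in>basis d A. \<Sum>y\<in>basis d A. \<Sum>z\<in>basis d B. \<Sum>w\<in>basis d B.
         g x z * cnj (g y z) * (g y w * cnj (g x w)))"
    by (simp add: op_trace_def op_mult_def ptrace_def ket_bra_def g_def sum_product
        cong: sum.cong)
  have r: "op_trace d B (op_mult d B (ptrace d B A (ket_bra \<psi>)) (ptrace d B A (ket_bra \<psi>))) =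
      (\<Sum>z\<in>basis d B. \<Sum>w\<in>basis d B. \<Sum>x\<in>basis d A. \<Sum>y\<in>basis d A.
         g x z * cnj (g x w) * (g y w * cnj (g y z)))"
    by (simp add: op_trace_def op_mult_def ptrace_def ket_bra_def g_def sum_product m
        cong: sum.cong)
  have "(\<Sum>x\<in>basis d A. \<Sum>y\<in>basis d A. \<Sum>z\<in>basis d B. \<Sum>w\<in>basis d B.
         g x z * cnj (g y z) * (g y w * cnj (g x w))) =
      (\<Sum>x\<in>basis d A. \<Sum>z\<in>basis d B. \<Sum>y\<in>basis d A. \<Sum>w\<in>basis d B.
         g x z * cnj (g y z) * (g y w * cnj (g x w)))"
    by (intro sum.cong refl sum.swap)
  also have "\<dots> = (\<Sum>z\<in>basis d B. \<Sum>x\<in>basis d A. \<Sum>y\<in>basis d A. \<Sum>w\<in>basis d B.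
         g x z * cnj (g y z) * (g y w * cnj (g x w)))"
    by (rule sum.swap)
  also have "\<dots> = (\<Sum>z\<in>basis d B. \<Sum>x\<in>basis d A. \<Sum>w\<in>basis d B. \<Sum>y\<in>basis d A.
         g x z * cnj (g y z) * (g y w * cnj (g x w)))"
    by (intro sum.cong refl sum.swap)
  also have "\<dots> = (\<Sum>z\<in>basis d B. \<Sum>w\<in>basis d B. \<Sum>x\<in>basis d A. \<Sum>y\<in>basis d A.
         g x z * cnj (g y z) * (g y w * cnj (g x w)))"
    by (intro sum.cong refl sum.swap)
  finally show ?thesis
    unfolding concurrence_def Let_def l r
    by (simp add: min.commute mult.assoc mult.left_commute mult.commute)
qed

lemma bip_concurrence_eq:
  assumes "{A, B} \<in> bipartitions n"
  shows "bip_concurrence n d {A, B} \<psi> = concurrence d A B \<psi>"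
proof -
  have ne: "A \<noteq> B" using assms by (auto simp: bipartitions_def)
  have part: "partition_on {1..n} {A, B}" using assms by (simp add: bipartitions_def)
  have dj: "A \<inter> B = {}"
    using part ne by (auto simp: partition_on_def disjoint_def)
  have un: "{1..n} = A \<union> B"
    using part by (auto simp: partition_on_def)
  have "{1..n} - A = B" "{1..n} - B = A"
    using dj un by auto
  moreover have "(SOME C. C \<in> {A, B}) \<in> {A, B}"
    by (rule someI[of _ A]) simp
  ultimately show ?thesis
    using concurrence_commute[OF dj, of d \<psi>] by (auto simp: bip_concurrence_def Let_def)
qed

text \<open>On pure states the convex roof agrees with the defining formula.\<close>

lemma gbc_pure_cong:
  assumes "ket_bra \<phi> = ket_bra \<psi>"
  shows "gbc_pure n d \<phi> = gbc_pure n d \<psi>"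
  using assms by (simp add: gbc_pure_def bip_concurrence_def concurrence_def)

lemma realizes_ket_bra:
  assumes S: "finite S" and \<psi>: "pure_state d S \<psi>"
    and r: "realizes d S (ket_bra \<psi>) m p \<phi>" and i: "i < m" "p i \<noteq> 0"
  shows "ket_bra (\<phi> i) = ket_bra \<psi>"
proof -
  let ?I = "basis d S"
  have fin: "finite ?I" unfolding basis_def using S by (intro finite_PiE) auto
  define ip where "ip u w = (\<Sum>x\<in>?I. cnj (u x) * w x)" for u w :: vect
  have ip_self: "ip u u = of_real (\<Sum>x\<in>?I. (cmod (u x))\<^sup>2)" for u
    by (simp only: ip_def of_real_sum complex_norm_square mult.commute)
  have ip_flip: "ip w u = cnj (ip u w)" for u w
    by (simp add: ip_def mult.commute)
  have quad: "(\<Sum>x\<in>?I. \<Sum>y\<in>?I. cnj (v x) * ket_bra u x y * v y) = of_real ((cmod (ip v u))\<^sup>2)"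
    for u v
  proof -
    have "(\<Sum>x\<in>?I. \<Sum>y\<in>?I. cnj (v x) * ket_bra u x y * v y) = ip v u * ip u v"
      by (simp add: ip_def ket_bra_def sum_product mult_ac)
    then show ?thesis by (simp only: ip_flip[of u v] complex_norm_square)
  qed
  have pr: "0 \<le> p j" "pure_state d S (\<phi> j)" if "j < m" for j
    using r that by (auto simp: realizes_def)
  have orth: "ip v (\<phi> i) = 0" if v: "ip v \<psi> = 0" for v
  proof -
    have eq: "ket_bra \<psi> x y = (\<Sum>j<m. of_real (p j) * ket_bra (\<phi> j) x y)" for x y
      using r unfolding realizes_def by metis
    have "(\<Sum>x\<in>?I. \<Sum>y\<in>?I. cnj (v x) * ket_bra \<psi> x y * v y) =
        (\<Sum>x\<in>?I. \<Sum>y\<in>?I. \<Sum>j<m. of_real (p j) * (cnj (v x) * ket_bra (\<phi> j) x y * v y))"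
      by (simp add: eq sum_distrib_left sum_distrib_right mult_ac)
    also have "\<dots> = (\<Sum>x\<in>?I. \<Sum>j<m. \<Sum>y\<in>?I.
        of_real (p j) * (cnj (v x) * ket_bra (\<phi> j) x y * v y))"
      by (intro sum.cong refl sum.swap)
    also have "\<dots> = (\<Sum>j<m. \<Sum>x\<in>?I. \<Sum>y\<in>?I.
        of_real (p j) * (cnj (v x) * ket_bra (\<phi> j) x y * v y))"
      by (rule sum.swap)
    also have "\<dots> = of_real (\<Sum>j<m. p j * (cmod (ip v (\<phi> j)))\<^sup>2)"
      by (simp add: sum_distrib_left[symmetric] quad)
    finally have "complex_of_real (\<Sum>j<m. p j * (cmod (ip v (\<phi> j)))\<^sup>2) = 0"
      using v by (simp add: quad)
    then have "(\<Sum>j<m. p j * (cmod (ip v (\<phi> j)))\<^sup>2) = 0"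
      using of_real_eq_0_iff by blast
    then have "p i * (cmod (ip v (\<phi> i)))\<^sup>2 = 0"
      using i pr by (subst (asm) sum_nonneg_eq_0_iff) auto
    then show ?thesis using i by simp
  qed
  define c where "c = ip \<psi> (\<phi> i)"
  define v where "v = (\<lambda>x. \<phi> i x - c * \<psi> x)"
  have n\<psi>: "ip \<psi> \<psi> = 1" and n\<phi>: "ip (\<phi> i) (\<phi> i) = 1"
    using \<psi> pr(2)[OF i(1)] unfolding ip_self pure_state_def by auto
  have ipv: "ip v w = ip (\<phi> i) w - cnj c * ip \<psi> w" for w
    by (simp add: ip_def v_def left_diff_distrib sum_subtractf sum_distrib_left mult.assoc)
  have ipv': "ip w v = ip w (\<phi> i) - c * ip w \<psi>" for w
    by (simp add: ip_def v_def right_diff_distrib sum_subtractf sum_distrib_left mult_ac)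
  have v0: "ip v \<psi> = 0"
    by (simp add: ipv n\<psi> ip_flip[of "\<phi> i" \<psi>] c_def)
  then have "ip v v = 0" by (simp add: ipv' orth)
  then have "(\<Sum>x\<in>?I. (cmod (v x))\<^sup>2) = 0" unfolding ip_self using of_real_eq_0_iff by blast
  then have "v x = 0" if "x \<in> ?I" for x
    using fin that by (subst (asm) sum_nonneg_eq_0_iff) auto
  moreover have "v x = 0" if "x \<notin> ?I" for x
    using that \<psi> pr(2)[OF i(1)] by (simp add: v_def pure_state_def)
  ultimately have eq: "\<phi> i x = c * \<psi> x" for x
    by (cases "x \<in> ?I") (auto simp: v_def)
  have "ip (\<phi> i) (\<phi> i) = c * cnj c * ip \<psi> \<psi>"
    by (simp add: ip_def eq sum_distrib_left mult_ac)
  then have "c * cnj c = 1" using n\<psi> n\<phi> by simp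
  then show ?thesis
    by (auto simp: ket_bra_def eq fun_eq_iff)
qed

lemma gbc_ket_bra:
  assumes \<psi>: "pure_state d {1..n} \<psi>"
  shows "gbc n d (ket_bra \<psi>) = gbc_pure n d \<psi>"
proof -
  have "(\<Sum>i<m. p i * gbc_pure n d (\<phi> i)) = gbc_pure n d \<psi>"
    if r: "realizes d {1..n} (ket_bra \<psi>) m p \<phi>" for m p \<phi>
  proof -
    have "(\<Sum>i<m. p i * gbc_pure n d (\<phi> i)) = (\<Sum>i<m. p i * gbc_pure n d \<psi>)"
      using gbc_pure_cong[OF realizes_ket_bra[OF _ \<psi> r]] by (intro sum.cong) auto
    also have "\<dots> = gbc_pure n d \<psi>"
      using r by (simp add: realizes_def flip: sum_distrib_right)
    finally show ?thesis .
  qed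
  moreover have "realizes d {1..n} (ket_bra \<psi>) 1 (\<lambda>_. 1) (\<lambda>_. \<psi>)"
    using \<psi> by (simp add: realizes_def)
  ultimately have "(\<exists>m p \<phi>. realizes d {1..n} (ket_bra \<psi>) m p \<phi> \<and>
      g = (\<Sum>i<m. p i * gbc_pure n d (\<phi> i))) \<longleftrightarrow> g = gbc_pure n d \<psi>" for g
    by metis
  then show ?thesis
    unfolding gbc_def by (auto intro: Least_equality)
qed

end

theory Submission
  imports Defs
begin

text \<open>
  For a vector \<open>v\<close> with coefficient matrix \<open>g\<close> along a bipartition, \<open>(tr \<rho>)\<^sup>2 - tr (\<rho>\<^sub>A\<^sup>2)\<close> is half the
  sum of \<open>|g x z * g y w - g x w * g y z|\<^sup>2\<close>, so the concurrence is, up to a dimensional factor, the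
  norm of the family of \<open>2 \<times> 2\<close> minors of \<open>g\<close>, and it vanishes exactly on product vectors. As a
  function of the reduced operator of the other side it is superadditive, hence it does not
  increase on average under local Kraus operators; by the generalised Hoelder inequality the same
  holds for the geometric mean over all bipartitions. The dimensional factors are dropped during
  the protocol, where local dimensions may change, and restored at the end, where they agree with
  the initial ones. Working with unnormalised vectors, a decomposition \<open>\<rho> = \<Sum>i. |v i><v i|\<close> is
  pushed through an LOCC protocol without increasing the total cost. Finally the minimum in
  the convex roof is attained: Caratheodory's theorem bounds the number of terms, and the
  decompositions with a bounded number of terms form a compact set. So a roof of value 0 is
  realised by an ensemble of biseparable pure states.
\<close>

section \<open>Superadditivity of minors and of geometric means\<close>

definition minors :: "'a set \<Rightarrow> 'b set \<Rightarrow> ('a \<Rightarrow> 'b \<Rightarrow> complex) \<Rightarrow> real" where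
  "minors X Z g = sqrt ((\<Sum>x\<in>X. \<Sum>y\<in>X. \<Sum>z\<in>Z. \<Sum>w\<in>Z.
     (cmod (g x z * g y w - g x w * g y z))\<^sup>2) / 2)"

lemma minors_nonneg: "minors X Z g \<ge> 0"
  unfolding minors_def by (intro real_sqrt_ge_zero divide_nonneg_nonneg sum_nonneg) auto

text \<open>Transposing a matrix only permutes its minors. This makes the two sides of a bipartition
  interchangeable and allows a choice between the Gram matrices of rows and of columns.\<close>

lemma minors_swap: "minors Z X (\<lambda>z x. g x z) = minors X Z g"
proof -
  have "(\<Sum>z\<in>Z. \<Sum>w\<in>Z. \<Sum>x\<in>X. \<Sum>y\<in>X. (cmod (g x z * g y w - g y z * g x w))\<^sup>2)
      = (\<Sum>z\<in>Z. \<Sum>x\<in>X. \<Sum>w\<in>Z. \<Sum>y\<in>X. (cmod (g x z * g y w - g y z * g x w))\<^sup>2)"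
    by (intro sum.cong refl sum.swap)
  also have "\<dots> = (\<Sum>x\<in>X. \<Sum>z\<in>Z. \<Sum>w\<in>Z. \<Sum>y\<in>X. (cmod (g x z * g y w - g y z * g x w))\<^sup>2)"
    by (rule sum.swap)
  also have "\<dots> = (\<Sum>x\<in>X. \<Sum>z\<in>Z. \<Sum>y\<in>X. \<Sum>w\<in>Z. (cmod (g x z * g y w - g y z * g x w))\<^sup>2)"
    by (intro sum.cong refl sum.swap)
  also have "\<dots> = (\<Sum>x\<in>X. \<Sum>y\<in>X. \<Sum>z\<in>Z. \<Sum>w\<in>Z. (cmod (g x z * g y w - g y z * g x w))\<^sup>2)"
    by (intro sum.cong refl sum.swap)
  finally show ?thesis
    unfolding minors_def by (simp add: mult.commute)
qed

lemma cmod_diff_square: "(cmod (a - b))\<^sup>2 = (cmod a)\<^sup>2 + (cmod b)\<^sup>2 - 2 * Re (a * cnj b)"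
  by (simp add: cmod_power2) (simp add: power2_eq_square algebra_simps)

text \<open>Lagrange's identity. After expanding each squared minor, both square terms sum to the
  squared trace, and the mixed term is the squared Hilbert-Schmidt norm of the Gram matrix of the
  rows.\<close>

lemma minors_power2:
  "(minors X Z g)\<^sup>2 = (\<Sum>x\<in>X. \<Sum>z\<in>Z. (cmod (g x z))\<^sup>2)\<^sup>2
     - (\<Sum>x\<in>X. \<Sum>y\<in>X. (cmod (\<Sum>z\<in>Z. g x z * cnj (g y z)))\<^sup>2)"
proof -
  define N where "N = (\<Sum>x\<in>X. \<Sum>z\<in>Z. (cmod (g x z))\<^sup>2)"
  define G where "G = (\<Sum>x\<in>X. \<Sum>y\<in>X. (cmod (\<Sum>z\<in>Z. g x z * cnj (g y z)))\<^sup>2)"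
  have a: "(\<Sum>x\<in>X. \<Sum>y\<in>X. \<Sum>z\<in>Z. \<Sum>w\<in>Z. (cmod (g x z * g y w))\<^sup>2) = N\<^sup>2"
    by (simp add: N_def power2_eq_square sum_product norm_mult mult_ac)
  have "(\<Sum>x\<in>X. \<Sum>y\<in>X. \<Sum>z\<in>Z. \<Sum>w\<in>Z. (cmod (g x w * g y z))\<^sup>2)
      = (\<Sum>x\<in>X. \<Sum>y\<in>X. \<Sum>w\<in>Z. \<Sum>z\<in>Z. (cmod (g x w * g y z))\<^sup>2)"
    by (intro sum.cong refl sum.swap)
  with a have b: "(\<Sum>x\<in>X. \<Sum>y\<in>X. \<Sum>z\<in>Z. \<Sum>w\<in>Z. (cmod (g x w * g y z))\<^sup>2) = N\<^sup>2"
    by simp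
  \<comment> \<open>The mixed term: the squared inner product of rows \<open>x\<close> and
    \<open>y\<close>, written as a double sum over columns, has the real parts that
    \<open>cmod_diff_square\<close> produces.\<close>
  have "complex_of_real ((cmod (\<Sum>z\<in>Z. g x z * cnj (g y z)))\<^sup>2)
      = (\<Sum>z\<in>Z. \<Sum>w\<in>Z. g x z * g y w * cnj (g x w * g y z))" for x y
    by (simp only: complex_norm_square cnj_sum sum_product)
       (simp add: mult_ac)
  then have "(cmod (\<Sum>z\<in>Z. g x z * cnj (g y z)))\<^sup>2
      = (\<Sum>z\<in>Z. \<Sum>w\<in>Z. Re (g x z * g y w * cnj (g x w * g y z)))" for x y
    by (metis (no_types, lifting) Re_complex_of_real Re_sum sum.cong)
  then have c: "(\<Sum>x\<in>X. \<Sum>y\<in>X. \<Sum>z\<in>Z. \<Sum>w\<in>Z. Re (g x z * g y w * cnj (g x w * g y z))) = G"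
    by (simp add: G_def)
  have "(\<Sum>x\<in>X. \<Sum>y\<in>X. \<Sum>z\<in>Z. \<Sum>w\<in>Z. (cmod (g x z * g y w - g x w * g y z))\<^sup>2)
     = N\<^sup>2 + N\<^sup>2 - 2 * G"
    unfolding cmod_diff_square sum.distrib sum_subtractf a b sum_distrib_left[symmetric] c ..
  moreover have "(minors X Z g)\<^sup>2 = (\<Sum>x\<in>X. \<Sum>y\<in>X. \<Sum>z\<in>Z. \<Sum>w\<in>Z.
     (cmod (g x z * g y w - g x w * g y z))\<^sup>2) / 2"
    unfolding minors_def
    by (intro real_sqrt_pow2 divide_nonneg_nonneg sum_nonneg) auto
  ultimately show ?thesis by (simp add: N_def G_def)
qed

lemma L2_set_sum_le:
  assumes "finite J"
  shows "L2_set (\<lambda>x. cmod (\<Sum>j\<in>J. f j x)) X \<le> (\<Sum>j\<in>J. L2_set (\<lambda>x. cmod (f j x)) X)"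
  using assms
proof (induction J)
  case empty
  then show ?case by (simp add: L2_set_def)
next
  case (insert j J)
  have "L2_set (\<lambda>x. cmod (\<Sum>j\<in>insert j J. f j x)) X
      \<le> L2_set (\<lambda>x. cmod (f j x) + cmod (\<Sum>j\<in>J. f j x)) X"
    using insert by (intro L2_set_mono) (auto intro: norm_triangle_ineq)
  also have "\<dots> \<le> L2_set (\<lambda>x. cmod (f j x)) X + L2_set (\<lambda>x. cmod (\<Sum>j\<in>J. f j x)) X"
    by (rule L2_set_triangle_ineq)
  finally show ?case using insert by simp
qed

text \<open>
  \<open>minors\<close> is \<open>sqrt (t\<^sup>2 - h\<^sup>2)\<close> with \<open>t\<close> the trace and \<open>h\<close> the Hilbert-Schmidt norm of the Gram matrix;
  it is superadditive by the triangle inequality in the plane for the vectors \<open>(sqrt (t\<^sup>2 - h\<^sup>2), h)\<close>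
  of length \<open>t\<close>.
\<close>

lemma minors_superadditive:
  assumes J: "finite J" and Z: "finite Z"
    and gram: "\<And>z w. z \<in> Z \<Longrightarrow> w \<in> Z \<Longrightarrow> (\<Sum>x\<in>X. g x z * cnj (g x w))
      = (\<Sum>j\<in>J. \<Sum>x\<in>Y j. h j x z * cnj (h j x w))"
  shows "(\<Sum>j\<in>J. minors (Y j) Z (h j)) \<le> minors X Z g"
proof -
  define H where "H j = L2_set (\<lambda>(z, w). cmod (\<Sum>x\<in>Y j. h j x z * cnj (h j x w))) (Z \<times> Z)" for j
  define H0 where "H0 = L2_set (\<lambda>(z, w). cmod (\<Sum>x\<in>X. g x z * cnj (g x w))) (Z \<times> Z)"
  define T where "T j = (\<Sum>z\<in>Z. \<Sum>x\<in>Y j. (cmod (h j x z))\<^sup>2)" for j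
  define T0 where "T0 = (\<Sum>z\<in>Z. \<Sum>x\<in>X. (cmod (g x z))\<^sup>2)"
  define s where "s j = minors (Y j) Z (h j)" for j
  have L2: "(L2_set (\<lambda>(z, w). cmod (f z w)) (Z \<times> Z))\<^sup>2 = (\<Sum>z\<in>Z. \<Sum>w\<in>Z. (cmod (f z w))\<^sup>2)" for f
    by (simp add: L2_set_def sum_nonneg sum.cartesian_product split_def)
  \<comment> \<open>The hypothesis \<open>gram\<close> speaks of columns, while
    \<open>minors_power2\<close> uses the Gram matrix of rows; hence the transposition.\<close>
  have sj: "(s j)\<^sup>2 = (T j)\<^sup>2 - (H j)\<^sup>2" for j
    unfolding s_def H_def L2 T_def
    by (subst minors_swap[symmetric], subst minors_power2) simp
  have s0: "(minors X Z g)\<^sup>2 = T0\<^sup>2 - H0\<^sup>2"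
    unfolding H0_def L2 T0_def
    by (subst minors_swap[symmetric], subst minors_power2) simp
  have Hn: "H j \<ge> 0" "H0 \<ge> 0" "T j \<ge> 0" "T0 \<ge> 0" for j
    by (auto simp: H_def H0_def T_def T0_def intro!: L2_set_nonneg sum_nonneg)
  have T: "T j = cmod (Complex (s j) (H j))" for j
    using sj[of j] Hn(3)[of j] by (simp add: cmod_def)
  \<comment> \<open>The diagonal of \<open>gram\<close> shows that the traces add up
    exactly.\<close>
  have "(\<Sum>z\<in>Z. \<Sum>x\<in>X. g x z * cnj (g x z)) =
      (\<Sum>z\<in>Z. \<Sum>j\<in>J. \<Sum>x\<in>Y j. h j x z * cnj (h j x z))"
    by (intro sum.cong refl gram)
  also have "\<dots> = (\<Sum>j\<in>J. \<Sum>z\<in>Z. \<Sum>x\<in>Y j. h j x z * cnj (h j x z))"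
    by (rule sum.swap)
  finally have "complex_of_real T0 = complex_of_real (\<Sum>j\<in>J. T j)"
    unfolding T_def T0_def of_real_sum complex_norm_square .
  then have Tsum: "T0 = (\<Sum>j\<in>J. T j)" by (rule of_real_eq_iff[THEN iffD1])
  \<comment> \<open>Hilbert-Schmidt norms obey only the triangle inequality; as they enter with a
    minus sign, this is the direction wanted.\<close>
  have "H0 = L2_set (\<lambda>u. cmod (\<Sum>j\<in>J. case u of (z, w) \<Rightarrow> \<Sum>x\<in>Y j. h j x z * cnj (h j x w))) (Z \<times> Z)"
    unfolding H0_def by (intro L2_set_cong) (auto simp: gram)
  also have "\<dots> \<le> (\<Sum>j\<in>J. H j)"
    unfolding H_def using L2_set_sum_le[OF J, of
        "\<lambda>j u. case u of (z, w) \<Rightarrow> \<Sum>x\<in>Y j. h j x z * cnj (h j x w)" "Z \<times> Z"]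
    by (simp add: split_def)
  finally have Hle: "H0 \<le> (\<Sum>j\<in>J. H j)" .
  have "cmod (\<Sum>j\<in>J. Complex (s j) (H j)) \<le> T0"
    unfolding Tsum T by (rule norm_sum)
  moreover have "(\<Sum>j\<in>J. Complex (s j) (H j)) = Complex (\<Sum>j\<in>J. s j) (\<Sum>j\<in>J. H j)"
    by (simp add: complex_eq_iff)
  ultimately have "sqrt ((\<Sum>j\<in>J. s j)\<^sup>2 + (\<Sum>j\<in>J. H j)\<^sup>2) \<le> T0"
    by (simp add: cmod_def)
  then have "(\<Sum>j\<in>J. s j)\<^sup>2 + (\<Sum>j\<in>J. H j)\<^sup>2 \<le> T0\<^sup>2"
    using sqrt_le_D by blast
  moreover have "H0\<^sup>2 \<le> (\<Sum>j\<in>J. H j)\<^sup>2"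
    using Hle Hn by (intro power_mono) auto
  ultimately have "(\<Sum>j\<in>J. s j)\<^sup>2 \<le> (minors X Z g)\<^sup>2" using s0 by linarith
  then show ?thesis
    unfolding s_def using minors_nonneg power2_le_imp_le by blast
qed

text \<open>Normalise each family \<open>a p\<close> by its sum \<open>s p\<close> and apply the
  inequality of arithmetic and geometric means for every \<open>j\<close>. Summed over
  \<open>j\<close>, the arithmetic means of the normalised terms give 1.\<close>

lemma geometric_mean_superadditive:
  fixes a :: "'p \<Rightarrow> 'j \<Rightarrow> real"
  assumes P: "finite P" "P \<noteq> {}" and J: "finite J"
    and pos: "\<And>p j. p \<in> P \<Longrightarrow> j \<in> J \<Longrightarrow> a p j \<ge> 0"
  shows "(\<Sum>j\<in>J. (\<Prod>p\<in>P. a p j) powr (1 / card P)) \<le> (\<Prod>p\<in>P. \<Sum>j\<in>J. a p j) powr (1 / card P)"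
proof (cases "\<exists>p\<in>P. (\<Sum>j\<in>J. a p j) = 0")
  case True
  \<comment> \<open>A zero sum of nonnegative terms puts a zero factor into every product on the
    left.\<close>
  then obtain p where p: "p \<in> P" "(\<Sum>j\<in>J. a p j) = 0" by blast
  have "(\<Prod>p\<in>P. a p j) = 0" if "j \<in> J" for j
    using p pos P J that by (intro prod_zero) (auto simp: sum_nonneg_eq_0_iff)
  then show ?thesis by simp
next
  case False
  define s where "s p = (\<Sum>j\<in>J. a p j)" for p
  have s: "s p > 0" if "p \<in> P" for p
    using False pos that unfolding s_def by (metis less_eq_real_def sum_nonneg)
  have c: "card P > 0" using P by (simp add: card_gt_0_iff)
  have "(\<Prod>p\<in>P. a p j) powr (1 / card P)
      \<le> (\<Prod>p\<in>P. s p) powr (1 / card P) * ((\<Sum>p\<in>P. a p j / s p) / card P)" if j: "j \<in> J" for j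
  proof -
    have "(\<Prod>p\<in>P. a p j) = (\<Prod>p\<in>P. s p) * (\<Prod>p\<in>P. a p j / s p)"
      using s by (subst prod.distrib[symmetric], intro prod.cong) (auto dest!: s)
    then have "(\<Prod>p\<in>P. a p j) powr (1 / card P)
        = (\<Prod>p\<in>P. s p) powr (1 / card P) * (\<Prod>p\<in>P. a p j / s p) powr (1 / card P)"
      using s pos j by (simp add: powr_mult prod_nonneg less_imp_le)
    also have "\<dots> \<le> (\<Prod>p\<in>P. s p) powr (1 / card P) * ((\<Sum>p\<in>P. a p j / s p) / card P)"
      using arith_geom_mean[OF P, of "\<lambda>p. a p j / s p"] s pos j
      by (intro mult_left_mono) (auto simp: sum_divide_distrib less_imp_le)
    finally show ?thesis .
  qed
  then have "(\<Sum>j\<in>J. (\<Prod>p\<in>P. a p j) powr (1 / card P))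
      \<le> (\<Sum>j\<in>J. (\<Prod>p\<in>P. s p) powr (1 / card P) * ((\<Sum>p\<in>P. a p j / s p) / card P))"
    by (rule sum_mono)
  also have "\<dots> = (\<Prod>p\<in>P. s p) powr (1 / card P) * ((\<Sum>j\<in>J. \<Sum>p\<in>P. a p j / s p) / card P)"
    by (simp add: sum_distrib_left sum_divide_distrib)
  also have "(\<Sum>j\<in>J. \<Sum>p\<in>P. a p j / s p) = (\<Sum>p\<in>P. \<Sum>j\<in>J. a p j / s p)"
    by (rule sum.swap)
  also have "\<dots> = (\<Sum>p\<in>P. 1)"
    using s by (intro sum.cong) (auto simp flip: sum_divide_distrib s_def dest!: s)
  finally show ?thesis using c by (simp add: s_def)
qed

section \<open>Local operations on unnormalised vectors\<close>

definition bip_minors :: "(nat \<Rightarrow> nat) \<Rightarrow> nat set \<Rightarrow> nat set \<Rightarrow> vect \<Rightarrow> real" where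
  "bip_minors d A B v = minors (basis d A) (basis d B) (\<lambda>x z. v (merge A B (x, z)))"

text \<open>The block is chosen exactly as in \<open>bip_concurrence\<close>, so that the two can be
  compared factor by factor.\<close>

definition bipartition_minors :: "nat \<Rightarrow> (nat \<Rightarrow> nat) \<Rightarrow> nat set set \<Rightarrow> vect \<Rightarrow> real" where
  "bipartition_minors n d P v = (let A = (SOME A. A \<in> P) in bip_minors d A ({1..n} - A) v)"

text \<open>
  Up to a factor depending only on the dimensions, \<open>gmean_minors\<close> extends \<open>gbc_pure\<close> to
  unnormalised vectors, homogeneously of degree 2; a weighted pure state \<open>p, \<psi>\<close> becomes the
  single vector \<open>sqrt p * \<psi>\<close>.
\<close>

definition gmean_minors :: "nat \<Rightarrow> (nat \<Rightarrow> nat) \<Rightarrow> vect \<Rightarrow> real" where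
  "gmean_minors n d v =
     (\<Prod>P\<in>bipartitions n. bipartition_minors n d P v) powr (1 / real (card (bipartitions n)))"

definition local_apply ::
  "(nat \<Rightarrow> nat) \<Rightarrow> nat set \<Rightarrow> nat \<Rightarrow> nat \<Rightarrow> (nat \<Rightarrow> nat \<Rightarrow> complex) \<Rightarrow> vect \<Rightarrow> vect" where
  "local_apply d S i e K v = (\<lambda>x. if x \<in> basis (d(i := e)) S
     then \<Sum>a<d i. K (x i) a * v (x(i := a)) else 0)"

section \<open>Bipartitions and homogeneity\<close>

lemma finite_basis [simp]: "finite S \<Longrightarrow> finite (basis d S)"
  unfolding basis_def by (intro finite_PiE) auto

lemma bipartitions_finite [simp]: "finite (bipartitions n)"
proof (rule finite_subset)
  show "bipartitions n \<subseteq> Pow (Pow {1..n})"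
    by (auto simp: bipartitions_def partition_on_def)
qed auto

lemma bipartitions_nonempty: "n \<ge> 2 \<Longrightarrow> bipartitions n \<noteq> {}"
proof -
  assume n: "n \<ge> 2"
  have U: "{1} \<union> {2..n} = {1..n}" and D: "{1} \<inter> {2..n} = {}" and N: "{2..n} \<noteq> {}"
    using n by auto
  have "partition_on {1..n} {{1}, {2..n}}"
    unfolding partition_on_def disjoint_def
  proof (intro conjI ballI impI)
    show "\<Union>{{1}, {2..n}} = {1..n}" using U by simp
    show "{} \<notin> {{1}, {2..n}}" using N by blast
    show "p \<inter> q = {}" if "p \<in> {{1}, {2..n}}" "q \<in> {{1}, {2..n}}" "p \<noteq> q" for p q
      using that D by blast
  qed
  moreover have "card {{1}, {2..n}} = 2" using D by (intro card_2_iff[THEN iffD2]) blast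
  ultimately show ?thesis
    unfolding bipartitions_def by blast
qed

lemma bipartitions_SOME:
  assumes "P \<in> bipartitions n"
  defines "A \<equiv> SOME A. A \<in> P"
  shows "A \<subseteq> {1..n}" "A \<noteq> {}" "{1..n} - A \<noteq> {}" "P = {A, {1..n} - A}"
proof -
  obtain B C where P: "P = {B, C}" "B \<noteq> C"
    using assms by (auto simp: bipartitions_def card_2_iff)
  have part: "partition_on {1..n} {B, C}" using assms P by (auto simp: bipartitions_def)
  have "A \<in> P" unfolding A_def using P by (metis insertI1 someI)
  moreover have "B \<inter> C = {}" "B \<union> C = {1..n}" "B \<noteq> {}" "C \<noteq> {}"
    using part P by (auto simp: partition_on_def disjoint_def)
  ultimately show "A \<subseteq> {1..n}" "A \<noteq> {}" "{1..n} - A \<noteq> {}" "P = {A, {1..n} - A}"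
    using P by auto
qed

lemma bip_minors_nonneg: "bip_minors d A B v \<ge> 0"
  by (simp add: bip_minors_def minors_nonneg)

lemma bipartition_minors_nonneg: "bipartition_minors n d P v \<ge> 0"
  by (simp add: bipartition_minors_def Let_def bip_minors_nonneg)

lemma gmean_minors_nonneg: "gmean_minors n d v \<ge> 0"
  by (simp add: gmean_minors_def)

lemma bip_minors_commute:
  assumes "A \<inter> B = {}"
  shows "bip_minors d A B v = bip_minors d B A v"
proof -
  have "merge A B (x, z) = merge B A (z, x)" for x z :: mindex
    using assms by (auto simp: merge_def fun_eq_iff)
  then show ?thesis
    unfolding bip_minors_def by (subst minors_swap[symmetric]) simp
qed

lemma bip_minors_scale: "bip_minors d A B (\<lambda>x. c * v x) = (cmod c)\<^sup>2 * bip_minors d A B v"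
proof -
  have "c * a * (c * b) - c * a' * (c * b') = c\<^sup>2 * (a * b - a' * b')" for a b a' b'
    by (simp add: power2_eq_square algebra_simps)
  then have "bip_minors d A B (\<lambda>x. c * v x) = sqrt (((cmod c)\<^sup>2)\<^sup>2 * (bip_minors d A B v)\<^sup>2)"
    unfolding bip_minors_def minors_def
    by (simp add: norm_mult norm_power power_mult_distrib sum_distrib_left[symmetric] sum_nonneg)
  also have "\<dots> = (cmod c)\<^sup>2 * bip_minors d A B v"
    by (simp only: real_sqrt_mult real_sqrt_abs)
       (simp add: bip_minors_nonneg)
  finally show ?thesis .
qed

text \<open>Each factor is homogeneous of degree 2, and the root undoes the number of factors. Some
  bipartition must exist, since the empty product would be the constant 1; this is where
  \<open>n \<ge> 2\<close> enters.\<close>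

lemma gmean_minors_scale:
  assumes "n \<ge> 2"
  shows "gmean_minors n d (\<lambda>x. c * v x) = (cmod c)\<^sup>2 * gmean_minors n d v"
proof -
  let ?m = "card (bipartitions n)"
  have m: "?m > 0" using bipartitions_nonempty[OF assms] by (simp add: card_gt_0_iff)
  have "bipartition_minors n d P (\<lambda>x. c * v x) = (cmod c)\<^sup>2 * bipartition_minors n d P v" for P
    by (simp add: bipartition_minors_def Let_def bip_minors_scale)
  then have "gmean_minors n d (\<lambda>x. c * v x) =
      (((cmod c)\<^sup>2) ^ ?m) powr (1 / ?m) * gmean_minors n d v"
    unfolding gmean_minors_def
    by (simp add: prod.distrib powr_mult prod_nonneg bipartition_minors_nonneg)
  also have "(((cmod c)\<^sup>2) ^ ?m) powr (1 / ?m) = (cmod c)\<^sup>2"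
  proof (cases "c = 0")
    case False
    then have "((cmod c)\<^sup>2) ^ ?m = (cmod c)\<^sup>2 powr ?m" by (subst powr_realpow) auto
    moreover have "real ?m * (1 / real ?m) = 1" using m
      by (metis less_irrefl nonzero_mult_div_cancel_left of_nat_0_less_iff times_divide_eq_right mult_1_right)
    ultimately show ?thesis by (simp only: powr_powr) simp
  qed (use m in auto)
  finally show ?thesis .
qed

lemma gmean_minors_zero: "n \<ge> 2 \<Longrightarrow> gmean_minors n d (\<lambda>_. 0) = 0"
  using gmean_minors_scale[of n d 0 "\<lambda>_. 0"] by simp

section \<open>Local Kraus operators acting on coefficient matrices\<close>

lemma sum_basis_split:
  assumes "i \<in> A"
  shows "(\<Sum>x\<in>basis d A. f x) = (\<Sum>y\<in>basis d (A - {i}). \<Sum>a<d i. f (y(i := a)))"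
proof -
  have "basis d A = basis d (insert i (A - {i}))" using assms by (simp add: insert_absorb)
  also have "\<dots> = (\<lambda>(a, y). y(i := a)) ` ({..<d i} \<times> basis d (A - {i}))"
    unfolding basis_def by (rule PiE_insert_eq)
  finally have img: "basis d A = (\<lambda>(a, y). y(i := a)) ` ({..<d i} \<times> basis d (A - {i}))" .
  have "(\<Sum>x\<in>basis d A. f x) = (\<Sum>(a, y)\<in>{..<d i} \<times> basis d (A - {i}). f (y(i := a)))"
    unfolding img unfolding basis_def by (subst sum.reindex[OF inj_combinator]) (auto simp: split_def)
  also have "\<dots> = (\<Sum>y\<in>basis d (A - {i}). \<Sum>a<d i. f (y(i := a)))"
    by (subst sum.swap) (simp add: sum.cartesian_product)
  finally show ?thesis .
qed

lemma merge_mem_basis: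
  "x \<in> basis d A \<Longrightarrow> z \<in> basis d B \<Longrightarrow> A \<inter> B = {} \<Longrightarrow> merge A B (x, z) \<in> basis d (A \<union> B)"
  by (auto simp: basis_def)

text \<open>An operator on a party in \<open>A\<close> acts on the row index of the coefficient
  matrix alone and leaves the column index \<open>z\<close> fixed.\<close>

lemma local_apply_merge:
  assumes AB: "A \<inter> B = {}" and i: "i \<in> A" and y: "y \<in> basis d (A - {i})" and c: "c < e"
    and z: "z \<in> basis d B"
  shows "local_apply d (A \<union> B) i e K v (merge A B (y(i := c), z))
    = (\<Sum>a<d i. K c a * v (merge A B (y(i := a), z)))"
proof -
  have iB: "i \<notin> B" using AB i by auto
  have "y(i := c) \<in> basis (d(i := e)) A"
    using y c i by (auto simp: basis_def PiE_iff extensional_def)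
  moreover have "z \<in> basis (d(i := e)) B"
    using z iB by (auto simp: basis_def PiE_iff extensional_def)
  ultimately have "merge A B (y(i := c), z) \<in> basis (d(i := e)) (A \<union> B)"
    using AB by (rule merge_mem_basis)
  moreover have "(merge A B (y(i := c), z))(i := a) = merge A B (y(i := a), z)" for a
    using i by (auto simp: merge_def)
  ultimately show ?thesis using i by (simp add: local_apply_def merge_def)
qed

text \<open>The completeness relation says that stacking all Kraus operators gives an isometry,
  which preserves inner products.\<close>

lemma kraus_gram:
  assumes "kraus_instrument D M e r K"
  shows "(\<Sum>k\<in>M. \<Sum>j<r k. \<Sum>c<e k. (\<Sum>a<D. K k j c a * f a) * cnj (\<Sum>b<D. K k j c b * g b))
    = (\<Sum>a<D. f a * cnj (g a))"
proof -
  have K: "(\<Sum>k\<in>M. \<Sum>j<r k. \<Sum>c<e k. K k j c a * cnj (K k j c b)) = (if b = a then 1 else 0)"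
    if "a < D" "b < D" for a b
    using assms that by (simp add: kraus_instrument_def mult.commute)
  have "(\<Sum>k\<in>M. \<Sum>j<r k. \<Sum>c<e k. (\<Sum>a<D. K k j c a * f a) * cnj (\<Sum>b<D. K k j c b * g b))
    = (\<Sum>k\<in>M. \<Sum>j<r k. \<Sum>c<e k. \<Sum>a<D. \<Sum>b<D. (K k j c a * cnj (K k j c b)) * (f a * cnj (g b)))"
    by (simp add: sum_product mult_ac)
  \<comment> \<open>The exchanges from here on carry the sums over \<open>a\<close> and
    \<open>b\<close> outward, until the completeness relation evaluates the inner triple
    sum.\<close>
  also have "\<dots> = (\<Sum>k\<in>M. \<Sum>j<r k. \<Sum>a<D. \<Sum>c<e k. \<Sum>b<D. (K k j c a * cnj (K k j c b)) * (f a * cnj (g b)))"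
    by (intro sum.cong refl sum.swap)
  also have "\<dots> = (\<Sum>k\<in>M. \<Sum>j<r k. \<Sum>a<D. \<Sum>b<D. \<Sum>c<e k. (K k j c a * cnj (K k j c b)) * (f a * cnj (g b)))"
    by (intro sum.cong refl sum.swap)
  also have "\<dots> = (\<Sum>k\<in>M. \<Sum>a<D. \<Sum>j<r k. \<Sum>b<D. \<Sum>c<e k. (K k j c a * cnj (K k j c b)) * (f a * cnj (g b)))"
    by (intro sum.cong refl sum.swap)
  also have "\<dots> = (\<Sum>k\<in>M. \<Sum>a<D. \<Sum>b<D. \<Sum>j<r k. \<Sum>c<e k. (K k j c a * cnj (K k j c b)) * (f a * cnj (g b)))"
    by (intro sum.cong refl sum.swap)
  also have "\<dots> = (\<Sum>a<D. \<Sum>k\<in>M. \<Sum>b<D. \<Sum>j<r k. \<Sum>c<e k. (K k j c a * cnj (K k j c b)) * (f a * cnj (g b)))"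
    by (rule sum.swap)
  also have "\<dots> = (\<Sum>a<D. \<Sum>b<D. \<Sum>k\<in>M. \<Sum>j<r k. \<Sum>c<e k. (K k j c a * cnj (K k j c b)) * (f a * cnj (g b)))"
    by (intro sum.cong refl sum.swap)
  also have "\<dots> = (\<Sum>a<D. \<Sum>b<D. (if b = a then 1 else 0) * (f a * cnj (g b)))"
    by (intro sum.cong refl) (simp add: K flip: sum_distrib_right)
  also have "\<dots> = (\<Sum>a<D. f a * cnj (g a))"
    by (intro sum.cong refl) (simp add: mult_delta_left)
  finally show ?thesis .
qed

text \<open>An instrument on side \<open>A\<close> preserves, on summing over outcomes, the Gram
  matrix of the columns, that is, the reduced operator of side \<open>B\<close>. This is the
  hypothesis of \<open>minors_superadditive\<close>.\<close>

lemma bip_minors_local_apply_left: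
  assumes fin: "finite A" "finite B" and AB: "A \<inter> B = {}" and i: "i \<in> A"
    and K: "kraus_instrument (d i) M e r K"
  shows "(\<Sum>(k, j)\<in>Sigma M (\<lambda>k. {..<r k}).
      bip_minors (d(i := e k)) A B (local_apply d (A \<union> B) i (e k) (K k j) v)) \<le> bip_minors d A B v"
proof -
  have M: "finite M" using K by (simp add: kraus_instrument_def)
  have B: "basis (d(i := e)) B = basis d B" for e
    using AB i unfolding basis_def by (intro PiE_cong) auto
  have A: "basis (d(i := e)) (A - {i}) = basis d (A - {i})" for e
    unfolding basis_def by (intro PiE_cong) auto
  have gram: "(\<Sum>x\<in>basis d A. v (merge A B (x, z)) * cnj (v (merge A B (x, w)))) =
     (\<Sum>u\<in>Sigma M (\<lambda>k. {..<r k}). \<Sum>x\<in>basis (d(i := e (fst u))) A.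
        local_apply d (A \<union> B) i (e (fst u)) (K (fst u) (snd u)) v (merge A B (x, z))
      * cnj (local_apply d (A \<union> B) i (e (fst u)) (K (fst u) (snd u)) v (merge A B (x, w))))"
    (is "?L = ?R") if zw: "z \<in> basis d B" "w \<in> basis d B" for z w
  proof -
    let ?f = "\<lambda>y z a. v (merge A B (y(i := a), z))"
    have "?R = (\<Sum>k\<in>M. \<Sum>j<r k. \<Sum>x\<in>basis (d(i := e k)) A.
        local_apply d (A \<union> B) i (e k) (K k j) v (merge A B (x, z))
      * cnj (local_apply d (A \<union> B) i (e k) (K k j) v (merge A B (x, w))))"
      using M by (subst sum.Sigma) (auto simp: split_def)
    \<comment> \<open>Each row index is split into coordinate \<open>i\<close> and the rest
      \<open>y\<close>; for fixed \<open>y\<close> the Kraus operators act on an ordinary vector of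
      length \<open>d i\<close>.\<close>
    also have "\<dots> = (\<Sum>k\<in>M. \<Sum>j<r k. \<Sum>y\<in>basis d (A - {i}). \<Sum>c<e k.
        (\<Sum>a<d i. K k j c a * ?f y z a) * cnj (\<Sum>b<d i. K k j c b * ?f y w b))"
      by (simp add: sum_basis_split[OF i] A local_apply_merge[OF AB i] zw del: cnj_sum)
    also have "\<dots> = (\<Sum>k\<in>M. \<Sum>y\<in>basis d (A - {i}). \<Sum>j<r k. \<Sum>c<e k.
        (\<Sum>a<d i. K k j c a * ?f y z a) * cnj (\<Sum>b<d i. K k j c b * ?f y w b))"
      by (intro sum.cong refl sum.swap)
    also have "\<dots> = (\<Sum>y\<in>basis d (A - {i}). \<Sum>k\<in>M. \<Sum>j<r k. \<Sum>c<e k.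
        (\<Sum>a<d i. K k j c a * ?f y z a) * cnj (\<Sum>b<d i. K k j c b * ?f y w b))"
      by (rule sum.swap)
    also have "\<dots> = ?L"
      unfolding kraus_gram[OF K] sum_basis_split[OF i] ..
    finally show ?thesis ..
  qed
  show ?thesis
    unfolding bip_minors_def B split_def
    by (rule minors_superadditive) (use fin M gram in auto)
qed

lemma bip_minors_local_apply:
  assumes fin: "finite A" "finite B" and AB: "A \<inter> B = {}" and i: "i \<in> A \<union> B"
    and K: "kraus_instrument (d i) M e r K"
  shows "(\<Sum>(k, j)\<in>Sigma M (\<lambda>k. {..<r k}).
      bip_minors (d(i := e k)) A B (local_apply d (A \<union> B) i (e k) (K k j) v)) \<le> bip_minors d A B v"
proof (cases "i \<in> A")
  case True
  then show ?thesis using assms by (intro bip_minors_local_apply_left)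
next
  case False
  then have "i \<in> B" using i by simp
  moreover have "B \<inter> A = {}" using AB by auto
  ultimately show ?thesis
    using bip_minors_local_apply_left[where d = d and i = i, OF fin(2,1) _ _ K, of v]
    by (simp add: bip_minors_commute[OF AB] Un_commute)
qed

text \<open>Each pair of an outcome and one of its Kraus operators counts as a separate branch. The
  bound for every single bipartition passes to the geometric mean by
  \<open>geometric_mean_superadditive\<close>.\<close>

lemma gmean_minors_local_apply:
  assumes n: "n \<ge> 2" and i: "i \<in> {1..n}" and K: "kraus_instrument (d i) M e r K"
  shows "(\<Sum>(k, j)\<in>Sigma M (\<lambda>k. {..<r k}).
      gmean_minors n (d(i := e k)) (local_apply d {1..n} i (e k) (K k j) v)) \<le> gmean_minors n d v"
proof -
  let ?m = "card (bipartitions n)" and ?J = "Sigma M (\<lambda>k. {..<r k})"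
  define a where "a P u = bipartition_minors n (d(i := e (fst u))) P
     (local_apply d {1..n} i (e (fst u)) (K (fst u) (snd u)) v)" for P u
  have M: "finite M" using K by (simp add: kraus_instrument_def)
  have "(\<Sum>u\<in>?J. a P u) \<le> bipartition_minors n d P v" if P: "P \<in> bipartitions n" for P
  proof -
    define A where "A = (SOME A. A \<in> P)"
    have A: "A \<subseteq> {1..n}" using bipartitions_SOME(1)[OF P] by (simp add: A_def)
    then have "A \<union> ({1..n} - A) = {1..n}" "finite A" by (auto intro: finite_subset)
    then show ?thesis
      using bip_minors_local_apply[of A "{1..n} - A" i d M e r K v] K i
      by (simp add: a_def bipartition_minors_def Let_def A_def[symmetric] split_def)
  qed
  then have "(\<Prod>P\<in>bipartitions n. \<Sum>u\<in>?J. a P u) powr (1 / ?m) \<le> gmean_minors n d v"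
    unfolding gmean_minors_def
    by (intro powr_mono2 prod_mono prod_nonneg) (auto simp: a_def bipartition_minors_nonneg intro!: sum_nonneg)
  moreover have "(\<Sum>u\<in>?J. (\<Prod>P\<in>bipartitions n. a P u) powr (1 / ?m))
      \<le> (\<Prod>P\<in>bipartitions n. \<Sum>u\<in>?J. a P u) powr (1 / ?m)"
    using bipartitions_nonempty[OF n] M
    by (intro geometric_mean_superadditive) (auto simp: a_def bipartition_minors_nonneg)
  ultimately show ?thesis
    by (simp add: gmean_minors_def a_def split_def)
qed

section \<open>Rank one decompositions under LOCC\<close>

text \<open>The vectors absorb the weights and no trace is prescribed, so the unnormalised operators
  inside a protocol are covered too.\<close>

definition decomposition :: "nat \<Rightarrow> (nat \<Rightarrow> nat) \<Rightarrow> oper \<Rightarrow> nat \<Rightarrow> (nat \<Rightarrow> vect) \<Rightarrow> bool" where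
  "decomposition n d \<rho> m v \<longleftrightarrow> (\<forall>i<m. \<forall>x. x \<notin> basis d {1..n} \<longrightarrow> v i x = 0) \<and>
     \<rho> = (\<lambda>x y. \<Sum>i<m. ket_bra (v i) x y)"

text \<open>The cost \<open>c\<close> belongs to some decomposition, not to an optimal one;
  minimisation is postponed to \<open>decomposes_min\<close>, so protocols can be followed without
  it.\<close>

definition decomposes :: "nat \<Rightarrow> (nat \<Rightarrow> nat) \<Rightarrow> oper \<Rightarrow> real \<Rightarrow> bool" where
  "decomposes n d \<rho> c \<longleftrightarrow>
     (\<exists>m v. decomposition n d \<rho> m v \<and> c = (\<Sum>i<m. gmean_minors n d (v i)))"

lemma ket_bra_sqrt_scale:
  "t \<ge> 0 \<Longrightarrow> ket_bra (\<lambda>x. of_real (sqrt t) * v x) x y = of_real t * ket_bra v x y"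
proof -
  assume "t \<ge> 0"
  then have "of_real (sqrt t) * of_real (sqrt t) = complex_of_real t"
    by (metis of_real_mult real_sqrt_mult_self abs_of_nonneg)
  then show ?thesis by (simp add: ket_bra_def)
qed

text \<open>Allows arbitrary finite index sets, such as pairs, in place of initial segments of the
  naturals.\<close>

lemma decomposition_sum_ket_bra:
  assumes I: "finite I" and supp: "\<And>i x. i \<in> I \<Longrightarrow> x \<notin> basis d {1..n} \<Longrightarrow> v i x = 0"
    and \<rho>: "\<And>x y. \<rho> x y = (\<Sum>i\<in>I. ket_bra (v i) x y)"
  obtains w where "decomposition n d \<rho> (card I) w"
    and "(\<Sum>i<card I. gmean_minors n d (w i)) = (\<Sum>i\<in>I. gmean_minors n d (v i))"
proof -
  obtain h where h: "bij_betw h {..<card I} I"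
    using ex_bij_betw_nat_finite[OF I] by (auto simp: atLeast0LessThan)
  have "decomposition n d \<rho> (card I) (\<lambda>i. v (h i))"
    unfolding decomposition_def
    using supp h by (auto simp: \<rho> fun_eq_iff bij_betw_apply sum.reindex_bij_betw[OF h, symmetric])
  moreover have "(\<Sum>i<card I. gmean_minors n d (v (h i))) = (\<Sum>i\<in>I. gmean_minors n d (v i))"
    by (rule sum.reindex_bij_betw[OF h])
  ultimately show ?thesis by (rule that)
qed

lemma decomposes_sum_ket_bra:
  assumes I: "finite I" and supp: "\<And>i x. i \<in> I \<Longrightarrow> x \<notin> basis d {1..n} \<Longrightarrow> v i x = 0"
    and \<rho>: "\<And>x y. \<rho> x y = (\<Sum>i\<in>I. ket_bra (v i) x y)"
    and c: "c = (\<Sum>i\<in>I. gmean_minors n d (v i))"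
  shows "decomposes n d \<rho> c"
  using decomposition_sum_ket_bra[where v = v, OF I supp \<rho>] c unfolding decomposes_def by metis

lemma decomposes_scale:
  assumes n: "n \<ge> 2" and "decomposes n d \<rho> c" and t: "t \<ge> 0"
  shows "decomposes n d (\<lambda>x y. of_real t * \<rho> x y) (t * c)"
proof -
  obtain m :: nat and v where supp: "\<forall>i<m. \<forall>x. x \<notin> basis d {1..n} \<longrightarrow> v i x = 0"
    and \<rho>: "\<rho> = (\<lambda>x y. \<Sum>i<m. ket_bra (v i) x y)" and c: "c = (\<Sum>i<m. gmean_minors n d (v i))"
    using assms(2) unfolding decomposes_def decomposition_def by blast
  show ?thesis
  proof (rule decomposes_sum_ket_bra[where I = "{..<m}" and v = "\<lambda>i x. of_real (sqrt t) * v i x"])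
    show "of_real t * \<rho> x y = (\<Sum>i<m. ket_bra (\<lambda>x. of_real (sqrt t) * v i x) x y)" for x y
      using t by (simp add: \<rho> ket_bra_sqrt_scale sum_distrib_left)
    show "t * c = (\<Sum>i<m. gmean_minors n d (\<lambda>x. of_real (sqrt t) * v i x))"
      using t by (simp add: c gmean_minors_scale[OF n] sum_distrib_left)
  qed (use supp in auto)
qed

text \<open>Decompositions are concatenated and their costs add. This is what handles branches
  merged into one classical outcome.\<close>

lemma decomposes_sum:
  assumes I: "finite I" and dec: "\<And>i. i \<in> I \<Longrightarrow> decomposes n d (\<rho> i) (c i)"
  shows "decomposes n d (\<lambda>x y. \<Sum>i\<in>I. \<rho> i x y) (\<Sum>i\<in>I. c i)"
proof -
  have "\<forall>i\<in>I. \<exists>m v. decomposition n d (\<rho> i) m v \<and> c i = (\<Sum>j<m. gmean_minors n d (v j))"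
    using dec by (simp add: decomposes_def)
  then obtain m v where mv: "\<And>i. i \<in> I \<Longrightarrow> decomposition n d (\<rho> i) (m i) (v i)"
    and c: "\<And>i. i \<in> I \<Longrightarrow> c i = (\<Sum>j<m i. gmean_minors n d (v i j))"
    by metis
  show ?thesis
  proof (rule decomposes_sum_ket_bra[where I = "SIGMA i:I. {..<m i}" and v = "\<lambda>(i, j). v i j"])
    show "(\<Sum>i\<in>I. \<rho> i x y) =
        (\<Sum>u\<in>(SIGMA i:I. {..<m i}). ket_bra (case u of (i, j) \<Rightarrow> v i j) x y)" for x y
    proof -
      have "\<rho> i x y = (\<Sum>j<m i. ket_bra (v i j) x y)" if "i \<in> I" for i
        using mv[OF that] by (simp add: decomposition_def)
      then have "(\<Sum>i\<in>I. \<rho> i x y) = (\<Sum>i\<in>I. \<Sum>j<m i. ket_bra (v i j) x y)" by simp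
      also have "\<dots> = (\<Sum>u\<in>(SIGMA i:I. {..<m i}). ket_bra (case u of (i, j) \<Rightarrow> v i j) x y)"
        using I by (subst sum.Sigma) (auto simp: split_def)
      finally show ?thesis .
    qed
    have "(\<Sum>i\<in>I. c i) = (\<Sum>i\<in>I. \<Sum>j<m i. gmean_minors n d (v i j))" using c by simp
    also have "\<dots> = (\<Sum>u\<in>(SIGMA i:I. {..<m i}). gmean_minors n d (case u of (i, j) \<Rightarrow> v i j))"
      using I by (subst sum.Sigma) (auto simp: split_def)
    finally show "(\<Sum>i\<in>I. c i) =
        (\<Sum>u\<in>(SIGMA i:I. {..<m i}). gmean_minors n d (case u of (i, j) \<Rightarrow> v i j))" .
  qed (use I mv in \<open>auto simp: decomposition_def\<close>)
qed

text \<open>A Kraus operator maps the rank one operator of a vector to that of the image vector, so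
  decompositions are carried to decompositions.\<close>

lemma local_op_sum_ket_bra:
  "local_op d S i e r K (\<lambda>x y. \<Sum>l\<in>I. ket_bra (v l) x y) x y
    = (\<Sum>j<r. \<Sum>l\<in>I. ket_bra (local_apply d S i e (K j) (v l)) x y)"
proof (cases "x \<in> basis (d(i := e)) S \<and> y \<in> basis (d(i := e)) S")
  case True
  have "(\<Sum>a<d i. \<Sum>b<d i. K j (x i) a * (\<Sum>l\<in>I. ket_bra (v l) (x(i := a)) (y(i := b))) * cnj (K j (y i) b))
      = (\<Sum>l\<in>I. ket_bra (local_apply d S i e (K j) (v l)) x y)" (is "?L = ?R") for j
  proof -
    have "?L = (\<Sum>a<d i. \<Sum>b<d i. \<Sum>l\<in>I. K j (x i) a * v l (x(i := a)) *
        cnj (K j (y i) b * v l (y(i := b))))"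
      by (simp add: ket_bra_def sum_distrib_left sum_distrib_right mult_ac)
    also have "\<dots> = (\<Sum>a<d i. \<Sum>l\<in>I. \<Sum>b<d i. K j (x i) a * v l (x(i := a)) *
        cnj (K j (y i) b * v l (y(i := b))))"
      by (intro sum.cong refl sum.swap)
    also have "\<dots> = (\<Sum>l\<in>I. \<Sum>a<d i. \<Sum>b<d i. K j (x i) a * v l (x(i := a)) *
        cnj (K j (y i) b * v l (y(i := b))))"
      by (rule sum.swap)
    also have "\<dots> = ?R"
      using True by (simp add: ket_bra_def local_apply_def sum_product)
    finally show ?thesis .
  qed
  then show ?thesis using True by (simp add: local_op_def)
next
  case False
  then show ?thesis by (auto simp: local_op_def ket_bra_def local_apply_def)
qed

lemma decomposes_local_op:
  assumes n: "n \<ge> 2" and i: "i \<in> {1..n}" and K: "kraus_instrument (d i) M e r K"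
    and dec: "decomposes n d \<rho> c"
  obtains c' where "\<And>k. k \<in> M \<Longrightarrow>
      decomposes n (d(i := e k)) (local_op d {1..n} i (e k) (r k) (K k) \<rho>) (c' k)"
    and "(\<Sum>k\<in>M. c' k) \<le> c"
proof -
  obtain m :: nat and v where \<rho>: "\<rho> = (\<lambda>x y. \<Sum>l<m. ket_bra (v l) x y)"
    and c: "c = (\<Sum>l<m. gmean_minors n d (v l))"
    using dec unfolding decomposes_def decomposition_def by blast
  define w where "w k = (\<lambda>(j, l). local_apply d {1..n} i (e k) (K k j) (v l))" for k
  define c' where "c' k = (\<Sum>u\<in>{..<r k} \<times> {..<m}. gmean_minors n (d(i := e k)) (w k u))" for k
  have dec': "decomposes n (d(i := e k)) (local_op d {1..n} i (e k) (r k) (K k) \<rho>) (c' k)" for k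
  proof (rule decomposes_sum_ket_bra[where v = "w k" and I = "{..<r k} \<times> {..<m}"])
    show "local_op d {1..n} i (e k) (r k) (K k) \<rho> x y
        = (\<Sum>u\<in>{..<r k} \<times> {..<m}. ket_bra (w k u) x y)" for x y
      unfolding \<rho> local_op_sum_ket_bra by (simp add: sum.cartesian_product w_def split_def)
  qed (auto simp: c'_def w_def local_apply_def)
  have M: "finite M" using K by (simp add: kraus_instrument_def)
  have "(\<Sum>k\<in>M. c' k) = (\<Sum>k\<in>M. \<Sum>j<r k. \<Sum>l<m. gmean_minors n (d(i := e k)) (w k (j, l)))"
    by (simp add: c'_def sum.cartesian_product)
  also have "\<dots> = (\<Sum>u\<in>Sigma M (\<lambda>k. {..<r k}). \<Sum>l<m. gmean_minors n (d(i := e (fst u))) (w (fst u) (snd u, l)))"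
    using M by (subst sum.Sigma) (auto simp: split_def)
  \<comment> \<open>Collecting all images of one fixed vector \<open>v l\<close> makes
    \<open>gmean_minors_local_apply\<close> applicable for each \<open>l\<close>.\<close>
  also have "\<dots> = (\<Sum>l<m. \<Sum>u\<in>Sigma M (\<lambda>k. {..<r k}). gmean_minors n (d(i := e (fst u))) (w (fst u) (snd u, l)))"
    by (rule sum.swap)
  also have "\<dots> \<le> c"
    unfolding c using gmean_minors_local_apply[where d = d, OF n i K]
    by (intro sum_mono) (simp add: w_def split_def)
  finally show ?thesis by (rule that[OF dec'])
qed

lemma locc_finite: "locc S d d' M \<E> \<Longrightarrow> finite M"
proof (induction rule: locc.induct)
  case (locc_round i d M e r K d' L \<F> f)
  then have "{f k l | k l. k \<in> M \<and> l \<in> L k} = (\<Union>k\<in>M. f k ` L k)" by auto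
  then show ?case using locc_round by (simp add: kraus_instrument_def)
qed simp

text \<open>Induction on the protocol: the first round distributes the cost over its outcomes, and
  each remaining protocol redistributes its share. The operator and the cost vary because every
  branch starts from its own.\<close>

lemma decomposes_locc:
  assumes n: "n \<ge> 2" and "locc {1..n} d d' M \<E>" and "decomposes n d \<rho> c"
  shows "\<exists>c'. (\<forall>m\<in>M. decomposes n d' (\<E> m \<rho>) (c' m)) \<and> (\<Sum>m\<in>M. c' m) \<le> c"
  using assms(2,3)
proof (induction arbitrary: \<rho> c rule: locc.induct)
  case (locc_stop d)
  then show ?case by (intro exI[of _ "\<lambda>_. c"]) simp
next
  case (locc_round i d M e r K d' L \<F> f)
  let ?\<rho> = "\<lambda>k. local_op d {1..n} i (e k) (r k) (K k) \<rho>"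
  let ?M = "{f k l | k l. k \<in> M \<and> l \<in> L k}"
  have M: "finite M" using locc_round.hyps by (simp add: kraus_instrument_def)
  have L: "finite (L k)" if "k \<in> M" for k
    using locc_round.hyps(3)[OF that] by (rule locc_finite)
  have fM: "finite ?M"
  proof -
    have "?M = (\<Union>k\<in>M. f k ` L k)" by auto
    then show ?thesis using M L by simp
  qed
  obtain c1 where c1: "\<And>k. k \<in> M \<Longrightarrow> decomposes n (d(i := e k)) (?\<rho> k) (c1 k)" "(\<Sum>k\<in>M. c1 k) \<le> c"
    using decomposes_local_op[OF n locc_round.hyps(1,2) locc_round.prems] by blast
  have "\<forall>k\<in>M. \<exists>c2. (\<forall>l\<in>L k. decomposes n d' (\<F> k l (?\<rho> k)) (c2 l)) \<and> (\<Sum>l\<in>L k. c2 l) \<le> c1 k"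
    using locc_round.IH c1(1) by blast
  then obtain c2 where c2: "\<And>k l. k \<in> M \<Longrightarrow> l \<in> L k \<Longrightarrow> decomposes n d' (\<F> k l (?\<rho> k)) (c2 k l)"
      "\<And>k. k \<in> M \<Longrightarrow> (\<Sum>l\<in>L k. c2 k l) \<le> c1 k"
    by metis
  define c' where "c' m = (\<Sum>k\<in>M. \<Sum>l | l \<in> L k \<and> f k l = m. c2 k l)" for m
  show ?case
  proof (intro exI conjI ballI)
    show "decomposes n d' (\<lambda>x y. \<Sum>k\<in>M. \<Sum>l | l \<in> L k \<and> f k l = m. \<F> k l (?\<rho> k) x y) (c' m)" for m
      unfolding c'_def using M L c2 by (intro decomposes_sum) auto
    have "(\<Sum>m\<in>?M. c' m) = (\<Sum>k\<in>M. \<Sum>m\<in>?M. \<Sum>l | l \<in> L k \<and> f k l = m. c2 k l)"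
      unfolding c'_def by (rule sum.swap)
    \<comment> \<open>For fixed \<open>k\<close>, the fibres of \<open>f k\<close> partition
      \<open>L k\<close>, so grouping by outcome names counts every branch once.\<close>
    also have "\<dots> = (\<Sum>k\<in>M. \<Sum>l\<in>L k. c2 k l)"
      using L fM by (intro sum.cong refl sum.group) auto
    also have "\<dots> \<le> (\<Sum>k\<in>M. c1 k)" by (intro sum_mono c2)
    also have "\<dots> \<le> c" by (rule c1)
    finally show "(\<Sum>m\<in>?M. c' m) \<le> c" .
  qed
qed

section \<open>Existence of optimal decompositions\<close>

text \<open>Gaussian elimination, one equation at a time: an equation with a nonzero coefficient
  removes one unknown from the remaining ones.\<close>

lemma homogeneous_system_nontrivial_solution:
  fixes a :: "'j \<Rightarrow> 'i \<Rightarrow> 'f::field"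
  assumes "finite J" "finite I" "card J < card I"
  shows "\<exists>c. (\<exists>i\<in>I. c i \<noteq> 0) \<and> (\<forall>j\<in>J. (\<Sum>i\<in>I. a j i * c i) = 0)"
  using assms
proof (induction J arbitrary: I a)
  case empty
  then have "I \<noteq> {}" by auto
  then show ?case by (intro exI[of _ "\<lambda>_. 1"]) auto
next
  case (insert j J)
  show ?case
  proof (cases "\<forall>i\<in>I. a j i = 0")
    case True
    moreover have "card J < card I" using insert.prems insert.hyps by simp
    then obtain c where "\<exists>i\<in>I. c i \<noteq> 0" "\<forall>j\<in>J. (\<Sum>i\<in>I. a j i * c i) = 0"
      using insert.IH[of I a] insert.prems by blast
    ultimately show ?thesis by (intro exI[of _ c]) auto
  next
    case False
    then obtain l where l: "l \<in> I" "a j l \<noteq> 0" by blast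
    define I' where "I' = I - {l}"
    have I': "finite I'" "card J < card I'" "I = insert l I'" "l \<notin> I'"
      using l insert by (auto simp: I'_def)
    obtain c where c: "\<exists>i\<in>I'. c i \<noteq> 0"
      "\<forall>k\<in>J. (\<Sum>i\<in>I'. (a k i - a k l * a j i / a j l) * c i) = 0"
      using insert.IH[OF I'(1,2), of "\<lambda>k i. a k i - a k l * a j i / a j l"] by blast
    \<comment> \<open>The value at \<open>l\<close> is the one that equation \<open>j\<close>
      forces.\<close>
    define c' where "c' = c(l := - (\<Sum>i\<in>I'. a j i * c i) / a j l)"
    have split: "(\<Sum>i\<in>I. a k i * c' i) = a k l * c' l + (\<Sum>i\<in>I'. a k i * c i)" for k
      using I' by (auto simp: c'_def intro!: sum.cong)
    have "(\<Sum>i\<in>I. a j i * c' i) = 0"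
      unfolding split using l by (simp add: c'_def)
    moreover have "(\<Sum>i\<in>I. a k i * c' i) = 0" if "k \<in> J" for k
    proof -
      have "(\<Sum>i\<in>I'. (a k i - a k l * a j i / a j l) * c i)
          = (\<Sum>i\<in>I'. a k i * c i) - a k l / a j l * (\<Sum>i\<in>I'. a j i * c i)"
        by (simp add: left_diff_distrib right_diff_distrib sum_subtractf sum_distrib_left mult_ac)
      then show ?thesis unfolding split using c(2) that by (simp add: c'_def)
    qed
    moreover have "\<exists>i\<in>I. c' i \<noteq> 0"
      using c(1) I' by (auto simp: c'_def)
    ultimately show ?thesis by blast
  qed
qed

text \<open>Symmetric Gaussian elimination: each step splits off one rank one operator.\<close>

lemma positive_semidefinite_sum_rank_one:
  fixes \<rho> :: "'a \<Rightarrow> 'a \<Rightarrow> complex"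
  assumes "finite I" and "\<And>v. (\<Sum>x\<in>I. \<Sum>y\<in>I. cnj (v x) * \<rho> x y * v y) \<in> \<real>\<^sub>\<ge>\<^sub>0"
  shows "\<exists>(m::nat) v. (\<forall>i<m. \<forall>x. x \<notin> I \<longrightarrow> v i x = 0) \<and>
    (\<forall>x\<in>I. \<forall>y\<in>I. \<rho> x y = (\<Sum>i<m. v i x * cnj (v i y)))"
  using assms
proof (induction I arbitrary: \<rho>)
  case empty
  then show ?case by auto
next
  case (insert a I)
  \<comment> \<open>The quadratic form of \<open>\<rho>\<close> at the vector with coordinate
    \<open>z\<close> at \<open>a\<close> and coordinates \<open>w\<close> on
    \<open>I\<close>.\<close>
  define q where "q z w = cnj z * \<rho> a a * z + cnj z * (\<Sum>y\<in>I. \<rho> a y * w y)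
     + (\<Sum>x\<in>I. cnj (w x) * \<rho> x a) * z + (\<Sum>x\<in>I. \<Sum>y\<in>I. cnj (w x) * \<rho> x y * w y)" for z w
  have expand: "(\<Sum>x\<in>insert a I. \<Sum>y\<in>insert a I. F x y) =
      F a a + (\<Sum>y\<in>I. F a y) + ((\<Sum>x\<in>I. F x a) + (\<Sum>x\<in>I. \<Sum>y\<in>I. F x y))"
    for F :: "'a \<Rightarrow> 'a \<Rightarrow> complex"
    using insert.hyps by (simp add: sum.distrib)
  have ne: "x \<noteq> a" if "x \<in> I" for x using that insert.hyps by auto
  have q: "q z w \<in> \<real>\<^sub>\<ge>\<^sub>0" for z w
  proof -
    have "(\<Sum>x\<in>insert a I. \<Sum>y\<in>insert a I. cnj ((w(a := z)) x) * \<rho> x y * (w(a := z)) y)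
      = cnj z * \<rho> a a * z + (\<Sum>y\<in>I. cnj z * \<rho> a y * w y)
       + ((\<Sum>x\<in>I. cnj (w x) * \<rho> x a * z) + (\<Sum>x\<in>I. \<Sum>y\<in>I. cnj (w x) * \<rho> x y * w y))"
      unfolding expand
      using ne by simp
    also have "\<dots> = q z w"
      by (simp add: q_def sum_distrib_left sum_distrib_right mult_ac)
    finally show ?thesis using insert.prems[of "w(a := z)"] by (simp only:)
  qed
  have pair: "q z (\<lambda>x. if x = y then s else 0) = cnj z * \<rho> a a * z + cnj z * \<rho> a y * s
      + cnj s * \<rho> y a * z + cnj s * \<rho> y y * s" if "y \<in> I" for z y s
  proof -
    have "(\<Sum>x\<in>I. \<rho> a x * (if x = y then s else 0)) = \<rho> a y * s"
      "(\<Sum>x\<in>I. cnj (if x = y then s else 0) * \<rho> x a) = cnj s * \<rho> y a"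
      "(\<Sum>x\<in>I. \<Sum>x'\<in>I. cnj (if x = y then s else 0) * \<rho> x x' * (if x' = y then s else 0))
         = cnj s * \<rho> y y * s"
      using that insert.hyps
      by (simp_all add: if_distrib[of cnj] mult_delta_left mult_delta_right cong: if_cong)
    then show ?thesis by (simp add: q_def mult_ac)
  qed
  have aa: "\<rho> a a \<in> \<real>\<^sub>\<ge>\<^sub>0" using q[of 1 "\<lambda>_. 0"] by (simp add: q_def)
  have herm: "\<rho> y a = cnj (\<rho> a y)" and yy: "\<rho> y y \<in> \<real>\<^sub>\<ge>\<^sub>0" if "y \<in> I" for y
  proof -
    show yy: "\<rho> y y \<in> \<real>\<^sub>\<ge>\<^sub>0" using q[of 0 "\<lambda>x. if x = y then 1 else 0"] pair[OF that, of 0 1] by simp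
    show "\<rho> y a = cnj (\<rho> a y)"
      \<comment> \<open>Polarisation: reality of the form at \<open>s = 1\<close> settles the
        imaginary part, and at \<open>s = \<i>\<close> the real part.\<close>
      using q[of 1 "\<lambda>x. if x = y then 1 else 0"] pair[OF that, of 1 1]
        q[of 1 "\<lambda>x. if x = y then \<i> else 0"] pair[OF that, of 1 \<i>] aa yy
      by (simp add: complex_nonneg_Reals_iff complex_eq_iff)
  qed
  define A where "A = Re (\<rho> a a)"
  have A: "\<rho> a a = of_real A" "A \<ge> 0"
    using aa by (auto simp: A_def complex_nonneg_Reals_iff complex_eq_iff)
  show ?case
  proof (cases "A = 0")
    case True
    have ay: "\<rho> a y = 0" if y: "y \<in> I" for y
    proof (rule ccontr)
      assume nz: "\<rho> a y \<noteq> 0"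
      \<comment> \<open>Chosen so that the form takes the value -1 at the test vector below, against
        positivity: a zero pivot forces a zero row.\<close>
      define t where "t = (Re (\<rho> y y) + 1) / (2 * (cmod (\<rho> a y))\<^sup>2)"
      have "q (- of_real t * \<rho> a y) (\<lambda>x. if x = y then 1 else 0)
          = \<rho> y y - 2 * of_real t * (\<rho> a y * cnj (\<rho> a y))"
        using True A by (subst pair[OF y]) (simp add: herm[OF y] algebra_simps)
      also have "\<dots> = \<rho> y y - 2 * of_real t * of_real ((cmod (\<rho> a y))\<^sup>2)"
        by (simp only: complex_norm_square)
      finally have "Re (\<rho> y y) - 2 * t * (cmod (\<rho> a y))\<^sup>2 \<ge> 0"
        using q[of "- of_real t * \<rho> a y" "\<lambda>x. if x = y then 1 else 0"]
        by (simp add: complex_nonneg_Reals_iff)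
      moreover have "2 * t * (cmod (\<rho> a y))\<^sup>2 = Re (\<rho> y y) + 1" using nz by (simp add: t_def)
      ultimately show False by simp
    qed
    have "(\<Sum>x\<in>I. \<Sum>y\<in>I. cnj (w x) * \<rho> x y * w y) \<in> \<real>\<^sub>\<ge>\<^sub>0" for w
      using q[of 0 w] by (simp add: q_def)
    from insert.IH[OF this] obtain m :: nat and v where
      v: "\<forall>i<m. \<forall>x. x \<notin> I \<longrightarrow> v i x = 0" "\<forall>x\<in>I. \<forall>y\<in>I. \<rho> x y = (\<Sum>i<m. v i x * cnj (v i y))"
      by blast
    then show ?thesis
      using insert.hyps ay herm A True by (intro exI[of _ m] exI[of _ v]) auto
  next
    case False
    then have A0: "A > 0" using A by simp
    \<comment> \<open>The Schur complement of the pivot is again positive semidefinite, because its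
      form at \<open>w\<close> is \<open>q\<close> at the minimising first coordinate.\<close>
    have "(\<Sum>x\<in>I. \<Sum>y\<in>I. cnj (w x) * (\<rho> x y - \<rho> x a * \<rho> a y / \<rho> a a) * w y) \<in> \<real>\<^sub>\<ge>\<^sub>0" for w
    proof -
      let ?L = "\<Sum>y\<in>I. \<rho> a y * w y" and ?R = "\<Sum>x\<in>I. cnj (w x) * \<rho> x a"
      have "(\<Sum>x\<in>I. \<Sum>y\<in>I. cnj (w x) * (\<rho> x y - \<rho> x a * \<rho> a y / \<rho> a a) * w y)
        = (\<Sum>x\<in>I. \<Sum>y\<in>I. cnj (w x) * \<rho> x y * w y) - ?R * ?L / \<rho> a a"
      proof -
        have "?R * ?L / \<rho> a a = (\<Sum>x\<in>I. \<Sum>y\<in>I. cnj (w x) * (\<rho> x a * \<rho> a y / \<rho> a a) * w y)"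
          by (simp only: sum_product sum_divide_distrib) (simp add: mult_ac)
        then show ?thesis by (simp add: right_diff_distrib left_diff_distrib sum_subtractf)
      qed
      also have "\<dots> = q (- ?L / \<rho> a a) w"
        using A0 by (simp add: q_def A field_simps)
      finally show ?thesis using q by simp
    qed
    from insert.IH[OF this] obtain m :: nat and v where
      v: "\<forall>i<m. \<forall>x. x \<notin> I \<longrightarrow> v i x = 0"
      "\<forall>x\<in>I. \<forall>y\<in>I. \<rho> x y - \<rho> x a * \<rho> a y / \<rho> a a = (\<Sum>i<m. v i x * cnj (v i y))"
      by blast
    \<comment> \<open>The vector split off is column \<open>a\<close> divided by the square root of
      the pivot.\<close>
    define u where "u x = (if x \<in> insert a I then \<rho> x a / of_real (sqrt A) else 0)" for x
    have herm': "\<rho> a y = cnj (\<rho> y a)" if "y \<in> insert a I" for y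
      using that herm A by auto
    have sq: "complex_of_real (sqrt A) * complex_of_real (sqrt A) = \<rho> a a"
      using A by (metis abs_of_nonneg of_real_mult real_sqrt_mult_self)
    have u: "u x * cnj (u y) = \<rho> x a * \<rho> a y / \<rho> a a"
      if "x \<in> insert a I" "y \<in> insert a I" for x y
      using that unfolding herm'[OF that(2)] sq[symmetric] u_def by simp
    have e: "\<rho> x y - \<rho> x a * \<rho> a y / \<rho> a a = (\<Sum>i<m. v i x * cnj (v i y))"
      if "x \<in> insert a I" "y \<in> insert a I" for x y
    proof (cases "x = a \<or> y = a")
      case True
      then show ?thesis using v(1) A0 A insert.hyps by auto
    next
      case False
      then have "x \<in> I" "y \<in> I" using that by auto
      then show ?thesis using v(2) by blast
    qed
    have "\<rho> x y = (\<Sum>i<Suc m. (v(m := u)) i x * cnj ((v(m := u)) i y))"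
      if "x \<in> insert a I" "y \<in> insert a I" for x y
    proof -
      have "(\<Sum>i<Suc m. (v(m := u)) i x * cnj ((v(m := u)) i y))
          = (\<Sum>i<m. v i x * cnj (v i y)) + u x * cnj (u y)"
        by simp
      then show ?thesis unfolding e[OF that, symmetric] u[OF that] by simp
    qed
    moreover have "\<forall>i<Suc m. \<forall>x. x \<notin> insert a I \<longrightarrow> (v(m := u)) i x = 0"
      using v(1) by (auto simp: u_def)
    ultimately show ?thesis by blast
  qed
qed

lemma density_op_decomposes:
  assumes "density_op d {1..n} \<rho>"
  shows "\<exists>c. decomposes n d \<rho> c"
proof -
  have "(\<Sum>x\<in>basis d {1..n}. \<Sum>y\<in>basis d {1..n}. cnj (v x) * \<rho> x y * v y) \<in> \<real>\<^sub>\<ge>\<^sub>0" for v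
    using assms by (simp add: density_op_def)
  from positive_semidefinite_sum_rank_one[OF _ this] obtain m :: nat and v where
    v: "\<forall>i<m. \<forall>x. x \<notin> basis d {1..n} \<longrightarrow> v i x = 0"
    "\<forall>x\<in>basis d {1..n}. \<forall>y\<in>basis d {1..n}. \<rho> x y = (\<Sum>i<m. v i x * cnj (v i y))"
    by auto
  have "\<rho> x y = (\<Sum>i<m. ket_bra (v i) x y)" for x y
  proof (cases "x \<in> basis d {1..n} \<and> y \<in> basis d {1..n}")
    case False
    then have "\<rho> x y = 0" using assms by (auto simp: density_op_def)
    with False show ?thesis using v(1) by (auto simp: ket_bra_def)
  qed (use v in \<open>auto simp: ket_bra_def\<close>)
  then have "decomposition n d \<rho> m v"
    using v(1) by (auto simp: decomposition_def)
  then show ?thesis by (auto simp: decomposes_def)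
qed

text \<open>Caratheodory's argument: more terms than the real dimension of the space of operators are redundant.\<close>

lemma decomposition_reduce:
  assumes n: "n \<ge> 2" and dec: "decomposition n d \<rho> m v"
    and m: "m > 2 * (card (basis d {1..n}))\<^sup>2"
  obtains w where "decomposition n d \<rho> (m - 1) w"
    and "(\<Sum>i<m - 1. gmean_minors n d (w i)) \<le> (\<Sum>i<m. gmean_minors n d (v i))"
proof -
  let ?I = "basis d {1..n}" and ?G = "\<lambda>i. gmean_minors n d (v i)"
  have supp: "v i x = 0" if "i < m" "x \<notin> ?I" for i x
    using dec that by (simp add: decomposition_def)
  have \<rho>: "\<rho> x y = (\<Sum>i<m. ket_bra (v i) x y)" for x y
    using dec by (simp add: decomposition_def)
  \<comment> \<open>Real and imaginary parts are separate equations, so that the linear relation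
    between the rank one operators has real coefficients.\<close>
  define a where "a = (\<lambda>(re, x, y) i. if re then Re (ket_bra (v i) x y) else Im (ket_bra (v i) x y))"
  have "card ((UNIV :: bool set) \<times> ?I \<times> ?I) < card {..<m}"
    using m by (simp add: card_cartesian_product power2_eq_square card_UNIV_bool)
  then obtain c0 where c0: "\<exists>i<m. c0 i \<noteq> 0"
    "\<forall>j\<in>UNIV \<times> ?I \<times> ?I. (\<Sum>i<m. a j i * c0 i) = 0"
    using homogeneous_system_nontrivial_solution[of "UNIV \<times> ?I \<times> ?I" "{..<m}" a] by auto
  have c0': "(\<Sum>i<m. of_real (c0 i) * ket_bra (v i) x y) = 0" for x y
  proof (cases "x \<in> ?I \<and> y \<in> ?I")
    case True
    then have "(\<Sum>i<m. a (re, x, y) i * c0 i) = 0" for re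
      using c0(2) by auto
    from this[of True] this[of False] show ?thesis
      by (simp add: complex_eq_iff a_def mult.commute)
  next
    case False
    then have "ket_bra (v i) x y = 0" if "i < m" for i
      using supp[OF that] by (auto simp: ket_bra_def)
    then show ?thesis by simp
  qed
  \<comment> \<open>The relation may be negated, so its sign can be chosen not to raise the
    cost.\<close>
  obtain c where c: "\<exists>i<m. c i \<noteq> 0" "\<And>x y. (\<Sum>i<m. of_real (c i) * ket_bra (v i) x y) = 0"
    "(\<Sum>i<m. c i * ?G i) \<le> 0"
  proof (cases "(\<Sum>i<m. c0 i * ?G i) \<le> 0")
    case True
    then show ?thesis using that c0 c0' by blast
  next
    case False
    show ?thesis
    proof (rule that[of "\<lambda>i. - c0 i"])
      show "(\<Sum>i<m. - c0 i * ?G i) \<le> 0" using False by (simp add: sum_negf)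
      show "(\<Sum>i<m. of_real (- c0 i) * ket_bra (v i) x y) = 0" for x y
        using c0'[of x y] by (simp add: sum_negf)
    qed (use c0 in auto)
  qed
  obtain s k where s: "\<And>i. i < m \<Longrightarrow> s i \<ge> 0" "\<And>x y. \<rho> x y = (\<Sum>i<m. of_real (s i) * ket_bra (v i) x y)"
    "(\<Sum>i<m. s i * ?G i) \<le> (\<Sum>i<m. ?G i)" and k: "k < m" "s k = 0"
  proof (cases "\<exists>i<m. c i < 0")
    case True
    \<comment> \<open>Starting from coefficients 1 and moving along the relation, the step
      \<open>- 1 / c k\<close> at the most negative \<open>c k\<close> is the largest that keeps all
      coefficients nonnegative, and it makes the coefficient of term \<open>k\<close> zero.\<close>
    define k where "k = arg_min_on c {..<m}"
    have ne: "{..<m} \<noteq> {}" using True by auto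
    have k: "k < m" using arg_min_if_finite(1)[OF _ ne, of c] by (simp add: k_def)
    have le: "c k \<le> c i" if "i < m" for i
      using arg_min_least[OF _ ne, of i c] that by (simp add: k_def)
    have neg: "c k < 0" using True le by fastforce
    show ?thesis
    proof (rule that[of "\<lambda>i. 1 + (- 1 / c k) * c i" k])
      show "0 \<le> 1 + (- 1 / c k) * c i" if "i < m" for i
        using le[OF that] neg by (simp add: field_simps)
      show "\<rho> x y = (\<Sum>i<m. of_real (1 + (- 1 / c k) * c i) * ket_bra (v i) x y)" for x y
      proof -
        have "(\<Sum>i<m. of_real (1 + (- 1 / c k) * c i) * ket_bra (v i) x y)
          = \<rho> x y + of_real (- 1 / c k) * (\<Sum>i<m. of_real (c i) * ket_bra (v i) x y)"
          unfolding \<rho>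
          by (simp only: of_real_add of_real_mult of_real_1 distrib_right sum.distrib sum_distrib_left mult.assoc mult_1_left)
        then show ?thesis by (simp add: c(2))
      qed
      have "(\<Sum>i<m. (1 + (- 1 / c k) * c i) * ?G i) = (\<Sum>i<m. ?G i) + (- 1 / c k) * (\<Sum>i<m. c i * ?G i)"
        by (simp only: distrib_right sum.distrib sum_distrib_left mult.assoc mult_1_left)
      also have "(- 1 / c k) * (\<Sum>i<m. c i * ?G i) \<le> 0"
        using neg c(3) by (intro mult_nonneg_nonpos) auto
      finally show "(\<Sum>i<m. (1 + (- 1 / c k) * c i) * ?G i) \<le> (\<Sum>i<m. ?G i)" by simp
    qed (use k neg in auto)
  next
    case False
    then obtain k where k: "k < m" "c k > 0" using c(1) by (metis linorder_neqE_linordered_idom)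
    have nn: "c i \<ge> 0" if "i < m" for i using False that by (meson not_less)
    have "v k x = 0" for x
    proof -
      have "complex_of_real (\<Sum>i<m. c i * (cmod (v i x))\<^sup>2) = 0"
        unfolding of_real_sum of_real_mult complex_norm_square
        using c(2)[of x x] by (simp add: ket_bra_def)
      then have "(\<Sum>i<m. c i * (cmod (v i x))\<^sup>2) = 0" by (rule of_real_eq_0_iff[THEN iffD1])
      then have "c k * (cmod (v k x))\<^sup>2 = 0"
        using nn k by (subst (asm) sum_nonneg_eq_0_iff) (auto dest: bspec[where x = k])
      then show ?thesis using k by simp
    qed
    then have kb: "ket_bra (v k) x y = 0" for x y by (simp add: ket_bra_def)
    show ?thesis
    proof (rule that[of "\<lambda>i. if i = k then 0 else 1" k])
      show "\<rho> x y = (\<Sum>i<m. of_real (if i = k then 0 else 1) * ket_bra (v i) x y)" for x y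
        unfolding \<rho> by (intro sum.cong) (auto simp: kb)
      show "(\<Sum>i<m. (if i = k then 0 else 1) * ?G i) \<le> (\<Sum>i<m. ?G i)"
        by (intro sum_mono) (auto simp: gmean_minors_nonneg)
    qed (use k in auto)
  qed
  have drop: "(\<Sum>i\<in>{..<m} - {k}. f i) = (\<Sum>i<m. f i)" if "f k = 0" for f :: "nat \<Rightarrow> 'b::comm_monoid_add"
    using k that by (subst sum.remove[of "{..<m}" k f]) auto
  have card: "card ({..<m} - {k}) = m - 1" using k by simp
  have cost: "(\<Sum>i\<in>{..<m} - {k}. gmean_minors n d (\<lambda>x. of_real (sqrt (s i)) * v i x))
      = (\<Sum>i<m. s i * ?G i)"
    using k s(1) by (subst drop) (auto simp: gmean_minors_scale[OF n] gmean_minors_zero[OF n])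
  have sum: "\<rho> x y = (\<Sum>i\<in>{..<m} - {k}. ket_bra (\<lambda>x. of_real (sqrt (s i)) * v i x) x y)" for x y
    using k by (subst drop) (auto simp: ket_bra_sqrt_scale s, simp add: ket_bra_def)
  obtain w where "decomposition n d \<rho> (card ({..<m} - {k})) w"
    "(\<Sum>i<card ({..<m} - {k}). gmean_minors n d (w i)) =
       (\<Sum>i\<in>{..<m} - {k}. gmean_minors n d (\<lambda>x. of_real (sqrt (s i)) * v i x))"
    by (rule decomposition_sum_ket_bra[of "{..<m} - {k}" d n "\<lambda>i x. of_real (sqrt (s i)) * v i x" \<rho>])
      (use supp sum in auto)
  then show ?thesis
    using that[of w] s(3) unfolding cost card by simp
qed

text \<open>Long decompositions are shortened repeatedly and short ones padded with zero vectors,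
  which cost nothing. Having exactly the same number of terms places all of them in one
  space.\<close>

lemma decomposition_bounded:
  assumes n: "n \<ge> 2" and dec: "decomposition n d \<rho> m v"
  shows "\<exists>w. decomposition n d \<rho> (2 * (card (basis d {1..n}))\<^sup>2) w \<and>
    (\<Sum>i<2 * (card (basis d {1..n}))\<^sup>2. gmean_minors n d (w i)) \<le> (\<Sum>i<m. gmean_minors n d (v i))"
  using dec
proof (induction m arbitrary: v rule: less_induct)
  case (less m)
  let ?N = "2 * (card (basis d {1..n}))\<^sup>2"
  show ?case
  proof (cases "m > ?N")
    case True
    obtain w where w: "decomposition n d \<rho> (m - 1) w"
      "(\<Sum>i<m - 1. gmean_minors n d (w i)) \<le> (\<Sum>i<m. gmean_minors n d (v i))"
      using decomposition_reduce[OF n less.prems True] by blast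
    have "m - 1 < m" using True by simp
    from less.IH[OF this w(1)] w(2) show ?thesis by (meson order_trans)
  next
    case False
    define w where "w i = (if i < m then v i else (\<lambda>_. 0))" for i
    have ext: "(\<Sum>i<m. f (v i)) = (\<Sum>i<?N. f (w i))" if "f (\<lambda>_. 0) = 0" for f :: "vect \<Rightarrow> 'b::comm_monoid_add"
      using False that by (intro sum.mono_neutral_cong_left) (auto simp: w_def)
    have "decomposition n d \<rho> ?N w"
      unfolding decomposition_def
    proof (intro conjI allI impI ext)
      show "w i x = 0" if "x \<notin> basis d {1..n}" for i x
        using less.prems that by (simp add: w_def decomposition_def)
      show "\<rho> = (\<lambda>x y. \<Sum>i<?N. ket_bra (w i) x y)"
        using less.prems ext[of "\<lambda>u. ket_bra u x y" for x y]
        by (simp add: decomposition_def fun_eq_iff ket_bra_def)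
    qed
    then show ?thesis using ext[of "gmean_minors n d"] gmean_minors_zero[OF n] by auto
  qed
qed

text \<open>A whole family of vectors is one point of a product space. The exponent is positive if
  bipartitions exist, which keeps the root continuous at 0; otherwise the function is
  constant.\<close>

lemma continuous_gmean_minors:
  "continuous_on UNIV (\<lambda>u :: nat \<times> mindex \<Rightarrow> complex. gmean_minors n d (\<lambda>x. u (i, x)))"
proof -
  have "continuous_on UNIV (\<lambda>u :: nat \<times> mindex \<Rightarrow> complex. bipartition_minors n d P (\<lambda>x. u (i, x)))" for P
    unfolding bipartition_minors_def bip_minors_def minors_def Let_def
    by (intro continuous_intros continuous_on_product_coordinates) auto
  then show ?thesis
    unfolding gmean_minors_def
    by (cases "bipartitions n = {}")
      (auto intro!: continuous_on_powr' continuous_on_prod continuous_on_const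
        simp: bipartition_minors_nonneg prod_nonneg card_gt_0_iff)
qed

text \<open>A continuous cost attains its minimum on the compact set \<open>T\<close> of
  decompositions with \<open>N\<close> terms, and by \<open>decomposition_bounded\<close> no
  decomposition of any length does better.\<close>

lemma decomposes_min:
  assumes n: "n \<ge> 2" and dec: "decomposes n d \<rho> c"
  shows "\<exists>c. decomposes n d \<rho> c \<and> (\<forall>c'. decomposes n d \<rho> c' \<longrightarrow> c \<le> c')"
proof -
  let ?I = "basis d {1..n}"
  define N where "N = 2 * (card ?I)\<^sup>2"
  \<comment> \<open>The diagonal entry of \<open>\<rho>\<close> at \<open>x\<close> is the sum of
    the squared moduli of the coordinates at \<open>x\<close>, which bounds each of them.\<close>
  define B where "B = (\<lambda>(i, x). if i < N \<and> x \<in> ?I then cball (0::complex) (sqrt (Re (\<rho> x x))) else {0})"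
  define T where "T = Pi\<^sub>E UNIV B \<inter> {u. \<forall>x y. \<rho> x y = (\<Sum>i<N. u (i, x) * cnj (u (i, y)))}"
  define f where "f u = (\<Sum>i<N. gmean_minors n d (\<lambda>x. u (i, x)))" for u :: "nat \<times> mindex \<Rightarrow> complex"
  \<comment> \<open>Tychonoff's theorem: there are infinitely many coordinates, each confined to a
    closed disc or to 0.\<close>
  have "compactin (product_topology (\<lambda>_. euclidean) UNIV) (Pi\<^sub>E UNIV B)"
    unfolding compactin_PiE by (auto simp: B_def compactin_euclidean_iff)
  then have "compact (Pi\<^sub>E UNIV B)"
    by (simp add: euclidean_product_topology compactin_euclidean_iff)
  moreover have "closed {u. \<forall>x y. \<rho> x y = (\<Sum>i<N. u (i, x) * cnj (u (i, y)))}"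
    by (intro closed_Collect_all closed_Collect_eq continuous_intros continuous_on_product_coordinates)
  ultimately have "compact T" unfolding T_def by (rule compact_Int_closed)
  have decT: "decomposition n d \<rho> N (\<lambda>i x. u (i, x))" if "u \<in> T" for u
  proof -
    have "u (i, x) = 0" if "x \<notin> ?I" for i x
      using \<open>u \<in> T\<close> that by (auto simp: T_def B_def PiE_iff dest!: spec[of _ i] spec[of _ x] split: if_splits)
    then show ?thesis using that by (simp add: decomposition_def T_def ket_bra_def fun_eq_iff)
  qed
  have Tdec: "\<exists>u\<in>T. f u \<le> c" if dc: "decomposes n d \<rho> c" for c
  proof -
    obtain m :: nat and v where "decomposition n d \<rho> m v" and c: "c = (\<Sum>i<m. gmean_minors n d (v i))"
      using dc unfolding decomposes_def by blast
    then obtain w where w: "decomposition n d \<rho> N w" "(\<Sum>i<N. gmean_minors n d (w i)) \<le> c"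
      using decomposition_bounded[OF n] unfolding N_def by blast
    define u where "u = (\<lambda>(i, x). if i < N then w i x else 0)"
    have \<rho>: "\<rho> x y = (\<Sum>i<N. w i x * cnj (w i y))" for x y
      using w(1) by (simp add: decomposition_def ket_bra_def)
    have bound: "cmod (w i x) \<le> sqrt (Re (\<rho> x x))" if "i < N" for i x
    proof -
      have "(cmod (w i x))\<^sup>2 \<le> (\<Sum>i<N. (cmod (w i x))\<^sup>2)"
        using that by (intro member_le_sum) auto
      also have "\<dots> = Re (\<rho> x x)"
        unfolding \<rho> by (simp add: complex_norm_square[symmetric] flip: of_real_sum)
      finally show ?thesis by (rule real_le_rsqrt)
    qed
    have "u \<in> T"
      using bound w(1) by (auto simp: T_def B_def u_def PiE_iff \<rho>[symmetric] decomposition_def)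
    moreover have "f u \<le> c" using w(2) by (simp add: f_def u_def)
    ultimately show ?thesis by blast
  qed
  have "T \<noteq> {}" using Tdec[OF dec] by blast
  moreover have "continuous_on T f"
    unfolding f_def by (intro continuous_on_sum continuous_on_subset[OF continuous_gmean_minors]) auto
  ultimately obtain u where u: "u \<in> T" "\<And>u'. u' \<in> T \<Longrightarrow> f u \<le> f u'"
    using continuous_attains_inf[OF \<open>compact T\<close>] by blast
  have "decomposes n d \<rho> (f u)"
    using decT[OF u(1)] by (auto simp: decomposes_def f_def)
  moreover have "f u \<le> c'" if "decomposes n d \<rho> c'" for c'
    using Tdec[OF that] u(2) by (meson order_trans)
  ultimately show ?thesis by blast
qed

section \<open>From minors to the geometric mean of bipartite concurrences\<close>

lemma sum_basis_merge:
  assumes "A \<inter> B = {}"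
  shows "(\<Sum>u\<in>basis d (A \<union> B). f u) = (\<Sum>x\<in>basis d A. \<Sum>z\<in>basis d B. f (merge A B (x, z)))"
proof -
  have "(\<Sum>u\<in>basis d (A \<union> B). f u) = (\<Sum>(x, z)\<in>basis d A \<times> basis d B. f (merge A B (x, z)))"
  proof (rule sum.reindex_bij_witness[where j = "\<lambda>u. (restrict u A, restrict u B)"
        and i = "\<lambda>u. merge A B u"])
    fix u assume "u \<in> basis d (A \<union> B)"
    then show "merge A B (restrict u A, restrict u B) = u"
      "(restrict u A, restrict u B) \<in> basis d A \<times> basis d B"
      "(case (restrict u A, restrict u B) of (x, z) \<Rightarrow> f (merge A B (x, z))) = f u"
      by (auto simp: basis_def PiE_iff extensional_restrict)
  next
    fix u assume "u \<in> basis d A \<times> basis d B"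
    then show "(restrict (merge A B u) A, restrict (merge A B u) B) = u"
      "merge A B u \<in> basis d (A \<union> B)"
      using assms merge_mem_basis[OF _ _ assms]
      by (auto simp: basis_def PiE_iff extensional_restrict)
  qed
  then show ?thesis by (simp add: sum.cartesian_product)
qed

lemma pure_state_merge_norm:
  assumes "pure_state d (A \<union> B) \<psi>" "A \<inter> B = {}"
  shows "(\<Sum>x\<in>basis d A. \<Sum>z\<in>basis d B. (cmod (\<psi> (merge A B (x, z))))\<^sup>2) = 1"
  using assms(1) by (simp add: pure_state_def sum_basis_merge[OF assms(2)])

definition concurrence_factor :: "(nat \<Rightarrow> nat) \<Rightarrow> nat set \<Rightarrow> nat set \<Rightarrow> real" where
  "concurrence_factor d A B = (let dmin = real (min (tdim d A) (tdim d B)) in sqrt (dmin / (dmin - 1)))"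

text \<open>For a unit vector the trace in \<open>minors_power2\<close> is 1, so the squared minors
  are 1 minus the purity of the reduced state.\<close>

lemma concurrence_eq_bip_minors:
  assumes \<psi>: "pure_state d (A \<union> B) \<psi>" and AB: "A \<inter> B = {}"
  shows "concurrence d A B \<psi> = concurrence_factor d A B * bip_minors d A B \<psi>"
proof -
  let ?g = "\<lambda>x z. \<psi> (merge A B (x, z))"
  let ?G = "\<lambda>x y. \<Sum>z\<in>basis d B. ?g x z * cnj (?g y z)"
  have G: "?G x y * ?G y x = of_real ((cmod (?G x y))\<^sup>2)" for x y
    by (simp only: complex_norm_square) (simp add: mult.commute)
  have "op_trace d A (op_mult d A (ptrace d A B (ket_bra \<psi>)) (ptrace d A B (ket_bra \<psi>)))
     = (\<Sum>x\<in>basis d A. \<Sum>y\<in>basis d A. ?G x y * ?G y x)"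
    by (simp add: op_trace_def op_mult_def ptrace_def ket_bra_def)
  also have "\<dots> = of_real (\<Sum>x\<in>basis d A. \<Sum>y\<in>basis d A. (cmod (?G x y))\<^sup>2)"
    unfolding G by simp
  finally have "1 - Re (op_trace d A (op_mult d A (ptrace d A B (ket_bra \<psi>)) (ptrace d A B (ket_bra \<psi>))))
     = (bip_minors d A B \<psi>)\<^sup>2"
    by (simp add: bip_minors_def minors_power2 pure_state_merge_norm[OF \<psi> AB])
  then show ?thesis
    unfolding concurrence_def concurrence_factor_def Let_def
    by (simp only: real_sqrt_mult real_sqrt_abs) (simp add: bip_minors_nonneg)
qed

definition gbc_factor :: "nat \<Rightarrow> (nat \<Rightarrow> nat) \<Rightarrow> real" where
  "gbc_factor n d = (\<Prod>P\<in>bipartitions n. let A = (SOME A. A \<in> P) in concurrence_factor d A ({1..n} - A))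
     powr (1 / real (card (bipartitions n)))"

lemma tdim_ge_2:
  assumes "finite A" "A \<noteq> {}" "\<forall>i\<in>A. d i \<ge> 2"
  shows "tdim d A \<ge> 2"
proof -
  obtain i where i: "i \<in> A" using assms by blast
  have "1 \<le> (\<Prod>j\<in>A - {i}. d j)" using assms by (intro prod_ge_1) auto
  then have "2 * 1 \<le> d i * (\<Prod>j\<in>A - {i}. d j)" using assms i by (intro mult_le_mono) auto
  then show ?thesis using assms i by (simp add: tdim_def prod.remove[of A i])
qed

lemma concurrence_factor_pos:
  assumes "tdim d A \<ge> 2" "tdim d B \<ge> 2"
  shows "concurrence_factor d A B > 0"
proof -
  have "real (min (tdim d A) (tdim d B)) \<ge> 2" using assms by simp
  then show ?thesis unfolding concurrence_factor_def Let_def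
    by (intro real_sqrt_gt_zero divide_pos_pos) linarith+
qed

lemma bipartition_concurrence_factor_pos:
  assumes d: "\<forall>i\<in>{1..n}. d i \<ge> 2" and P: "P \<in> bipartitions n"
  shows "(let A = (SOME A. A \<in> P) in concurrence_factor d A ({1..n} - A)) > 0"
proof -
  define A where "A = (SOME A. A \<in> P)"
  have A: "A \<subseteq> {1..n}" "A \<noteq> {}" "{1..n} - A \<noteq> {}"
    using bipartitions_SOME(1-3)[OF P] by (simp_all add: A_def)
  then have "finite A" by (auto intro: finite_subset)
  then have "tdim d A \<ge> 2" "tdim d ({1..n} - A) \<ge> 2"
    using A d by (auto intro!: tdim_ge_2)
  then show ?thesis unfolding Let_def A_def[symmetric] by (rule concurrence_factor_pos)
qed

text \<open>Positivity lets the dimensional factor be multiplied into inequalities and makes the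
  roof vanish exactly when the minimal cost does.\<close>

lemma gbc_factor_pos:
  assumes "\<forall>i\<in>{1..n}. d i \<ge> 2"
  shows "gbc_factor n d > 0"
proof -
  have "(\<Prod>P\<in>bipartitions n. let A = (SOME A. A \<in> P) in concurrence_factor d A ({1..n} - A)) > 0"
    using bipartition_concurrence_factor_pos[OF assms] by (rule prod_pos)
  then show ?thesis unfolding gbc_factor_def
    by (rule powr_gt_zero[THEN iffD2, OF less_imp_neq[THEN not_sym]])
qed

lemma gbc_pure_eq_gmean_minors:
  assumes \<psi>: "pure_state d {1..n} \<psi>" and d: "\<forall>i\<in>{1..n}. d i \<ge> 2"
  shows "gbc_pure n d \<psi> = gbc_factor n d * gmean_minors n d \<psi>"
proof -
  have eq: "bip_concurrence n d P \<psi> = (let A = (SOME A. A \<in> P) in concurrence_factor d A ({1..n} - A))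
      * bipartition_minors n d P \<psi>" if "P \<in> bipartitions n" for P
  proof -
    define A where "A = (SOME A. A \<in> P)"
    have "A \<union> ({1..n} - A) = {1..n}" using bipartitions_SOME(1)[OF that] by (auto simp: A_def)
    then have "concurrence d A ({1..n} - A) \<psi> = concurrence_factor d A ({1..n} - A) * bip_minors d A ({1..n} - A) \<psi>"
      using \<psi> by (intro concurrence_eq_bip_minors) auto
    then show ?thesis by (simp add: bip_concurrence_def bipartition_minors_def A_def Let_def)
  qed
  have "(\<Prod>P\<in>bipartitions n. bip_concurrence n d P \<psi>) =
      (\<Prod>P\<in>bipartitions n. let A = (SOME A. A \<in> P) in concurrence_factor d A ({1..n} - A))
      * (\<Prod>P\<in>bipartitions n. bipartition_minors n d P \<psi>)"
    unfolding prod.distrib[symmetric] by (intro prod.cong refl eq)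
  then show ?thesis
    unfolding gbc_pure_def gbc_factor_def gmean_minors_def
    by (simp only: powr_mult)
qed

section \<open>Ensembles of pure states and rank one decompositions\<close>

lemma decomposes_nonneg: "decomposes n d \<rho> c \<Longrightarrow> c \<ge> 0"
  by (auto simp: decomposes_def gmean_minors_nonneg intro!: sum_nonneg)

lemma realizes_decomposes:
  assumes n: "n \<ge> 2" and r: "realizes d {1..n} \<rho> m p \<psi>"
  shows "decomposes n d \<rho> (\<Sum>i<m. p i * gmean_minors n d (\<psi> i))"
proof (rule decomposes_sum_ket_bra[where I = "{..<m}" and v = "\<lambda>i x. of_real (sqrt (p i)) * \<psi> i x"])
  have p: "p i \<ge> 0" if "i < m" for i using r that by (simp add: realizes_def)
  show "\<rho> x y = (\<Sum>i<m. ket_bra (\<lambda>x. of_real (sqrt (p i)) * \<psi> i x) x y)" for x y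
    using r p by (simp add: realizes_def ket_bra_sqrt_scale)
  show "(\<Sum>i<m. p i * gmean_minors n d (\<psi> i))
      = (\<Sum>i<m. gmean_minors n d (\<lambda>x. of_real (sqrt (p i)) * \<psi> i x))"
    using p by (simp add: gmean_minors_scale[OF n])
qed (use r in \<open>auto simp: realizes_def pure_state_def\<close>)

lemma op_trace_decomposition:
  assumes "decomposition n d \<rho> m v"
  shows "op_trace d {1..n} \<rho> = of_real (\<Sum>i<m. \<Sum>x\<in>basis d {1..n}. (cmod (v i x))\<^sup>2)"
proof -
  have "op_trace d {1..n} \<rho> = (\<Sum>x\<in>basis d {1..n}. \<Sum>i<m. v i x * cnj (v i x))"
    using assms by (simp add: decomposition_def op_trace_def ket_bra_def)
  also have "\<dots> = (\<Sum>i<m. \<Sum>x\<in>basis d {1..n}. v i x * cnj (v i x))" by (rule sum.swap)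
  finally show ?thesis by (simp only: of_real_sum complex_norm_square)
qed

lemma decomposition_realizes:
  assumes n: "n \<ge> 2" and dec: "decomposition n d \<rho> m v" and tr: "op_trace d {1..n} \<rho> = 1"
  obtains p \<psi> where "realizes d {1..n} \<rho> m p \<psi>"
    and "(\<Sum>i<m. p i * gmean_minors n d (\<psi> i)) = (\<Sum>i<m. gmean_minors n d (v i))"
proof -
  let ?I = "basis d {1..n}"
  define p where "p i = (\<Sum>x\<in>?I. (cmod (v i x))\<^sup>2)" for i
  \<comment> \<open>Trace 1 rules out an empty basis. A basis vector then serves as the pure state
    for zero vectors, which receive weight 0.\<close>
  obtain x0 where x0: "x0 \<in> ?I" using tr by (fastforce simp: op_trace_def)
  define \<psi> where "\<psi> i = (if p i = 0 then (\<lambda>x. if x = x0 then 1 else 0)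
      else (\<lambda>x. of_real (1 / sqrt (p i)) * v i x))" for i
  have supp: "v i x = 0" if "i < m" "x \<notin> ?I" for i x
    using dec that by (simp add: decomposition_def)
  have p0: "p i \<ge> 0" for i by (simp add: p_def sum_nonneg)
  have v: "v i = (\<lambda>x. of_real (sqrt (p i)) * \<psi> i x)" if "i < m" for i
  proof (cases "p i = 0")
    case True
    then have "v i x = 0" for x
      using supp[OF that, of x] by (cases "x \<in> ?I") (auto simp: p_def sum_nonneg_eq_0_iff)
    then show ?thesis using True by auto
  qed (auto simp: \<psi>_def)
  have pure: "pure_state d {1..n} (\<psi> i)" if "i < m" for i
  proof (cases "p i = 0")
    case True
    have "(\<Sum>x\<in>?I. (cmod (if x = x0 then 1 else 0))\<^sup>2) = (\<Sum>x\<in>?I. if x = x0 then 1 else 0)"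
      by (intro sum.cong) auto
    then show ?thesis using True x0 by (auto simp: pure_state_def \<psi>_def)
  next
    case False
    then have "(\<Sum>x\<in>?I. (cmod (\<psi> i x))\<^sup>2) = (1 / sqrt (p i))\<^sup>2 * p i"
      unfolding p_def[of i] sum_distrib_left
      by (simp add: \<psi>_def norm_mult norm_divide power_mult_distrib p_def power_divide)
    also have "\<dots> = 1" using False p0[of i] by (simp add: power_divide)
    finally show ?thesis using False supp[OF that] by (simp add: pure_state_def \<psi>_def)
  qed
  have "complex_of_real (\<Sum>i<m. p i) = 1"
    using op_trace_decomposition[OF dec] tr by (simp add: p_def)
  then have "(\<Sum>i<m. p i) = 1" by (rule of_real_eq_1_iff[THEN iffD1])
  moreover have "\<rho> = (\<lambda>x y. \<Sum>i<m. of_real (p i) * ket_bra (\<psi> i) x y)"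
    using dec v p0 by (simp add: decomposition_def flip: ket_bra_sqrt_scale)
  ultimately have "realizes d {1..n} \<rho> m p \<psi>" using p0 pure by (simp add: realizes_def)
  moreover have "p i * gmean_minors n d (\<psi> i) = gmean_minors n d (v i)" if "i < m" for i
    using p0 by (subst v[OF that]) (simp add: gmean_minors_scale[OF n])
  then have "(\<Sum>i<m. p i * gmean_minors n d (\<psi> i)) = (\<Sum>i<m. gmean_minors n d (v i))" by simp
  ultimately show ?thesis by (rule that)
qed

text \<open>Ensembles and decompositions translate into each other with equal cost, so the
  \<open>LEAST\<close> in \<open>gbc\<close> is an attained minimum.\<close>

lemma gbc_eq_min_decomposes:
  assumes n: "n \<ge> 2" and d: "\<forall>i\<in>{1..n}. d i \<ge> 2"
    and tr: "op_trace d {1..n} \<rho> = 1" and dec: "decomposes n d \<rho> c"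
  obtains c0 where "decomposes n d \<rho> c0" "\<And>c'. decomposes n d \<rho> c' \<Longrightarrow> c0 \<le> c'"
    "gbc n d \<rho> = gbc_factor n d * c0"
proof -
  obtain c0 where c0: "decomposes n d \<rho> c0" "\<And>c'. decomposes n d \<rho> c' \<Longrightarrow> c0 \<le> c'"
    using decomposes_min[OF n dec] by blast
  have cost: "(\<Sum>i<m. p i * gbc_pure n d (\<psi> i)) = gbc_factor n d * (\<Sum>i<m. p i * gmean_minors n d (\<psi> i))"
    if "realizes d {1..n} \<rho> m p \<psi>" for m p \<psi>
    using that d by (simp add: realizes_def gbc_pure_eq_gmean_minors sum_distrib_left mult_ac)
  have "gbc n d \<rho> = gbc_factor n d * c0"
    unfolding gbc_def
  proof (rule Least_equality)
    obtain m v where v: "decomposition n d \<rho> m v" "c0 = (\<Sum>i<m. gmean_minors n d (v i))"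
      using c0(1) unfolding decomposes_def by blast
    obtain p \<psi> where p: "realizes d {1..n} \<rho> m p \<psi>" "(\<Sum>i<m. p i * gmean_minors n d (\<psi> i)) = c0"
      using decomposition_realizes[OF n v(1) tr] v(2) by metis
    show "\<exists>m p \<psi>. realizes d {1..n} \<rho> m p \<psi> \<and> gbc_factor n d * c0 = (\<Sum>i<m. p i * gbc_pure n d (\<psi> i))"
      using p(1) cost[OF p(1), unfolded p(2)] by metis
    fix g assume "\<exists>m p \<psi>. realizes d {1..n} \<rho> m p \<psi> \<and> g = (\<Sum>i<m. p i * gbc_pure n d (\<psi> i))"
    then obtain m p \<psi> where r: "realizes d {1..n} \<rho> m p \<psi>" and g: "g = (\<Sum>i<m. p i * gbc_pure n d (\<psi> i))"
      by blast
    show "gbc_factor n d * c0 \<le> g"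
      unfolding g cost[OF r]
      using c0(2)[OF realizes_decomposes[OF n r]] gbc_factor_pos[OF d] by simp
  qed
  with c0 show ?thesis by (rule that)
qed

section \<open>Product vectors and vanishing minors\<close>

lemma bipartitions_pairD:
  assumes "{A, B} \<in> bipartitions n"
  shows "A \<inter> B = {}" "A \<union> B = {1..n}"
proof -
  have "A \<noteq> B" using assms by (auto simp: bipartitions_def)
  then show "A \<inter> B = {}" "A \<union> B = {1..n}"
    using assms by (auto simp: bipartitions_def partition_on_def disjoint_def)
qed

lemma bipartition_minors_pair:
  assumes "{A, B} \<in> bipartitions n"
  shows "bipartition_minors n d {A, B} v = bip_minors d A B v"
proof -
  have "{1..n} - A = B" "{1..n} - B = A" using bipartitions_pairD[OF assms] by auto
  moreover have "(SOME C. C \<in> {A, B}) = A \<or> (SOME C. C \<in> {A, B}) = B"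
    using someI[of "\<lambda>C. C \<in> {A, B}" A] by blast
  ultimately show ?thesis
    using bip_minors_commute[OF bipartitions_pairD(1)[OF assms]]
    by (auto simp: bipartition_minors_def Let_def)
qed

text \<open>The coefficient matrix of a product vector has rank one, and a single vanishing factor
  annihilates the geometric mean.\<close>

lemma biseparable_pure_gmean_minors:
  assumes "biseparable_pure n d \<psi>"
  shows "gmean_minors n d \<psi> = 0"
proof -
  obtain A B \<phi> \<eta> where AB: "{A, B} \<in> bipartitions n" and \<psi>: "\<psi> = tensor d A B \<phi> \<eta>"
    using assms by (auto simp: biseparable_pure_def)
  have dj: "A \<inter> B = {}" by (rule bipartitions_pairD[OF AB])
  have "\<psi> (merge A B (x, z)) = \<phi> x * \<eta> z" if "x \<in> basis d A" "z \<in> basis d B" for x z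
    using merge_mem_basis[OF that dj] that dj
    by (simp add: \<psi> tensor_def basis_def PiE_iff extensional_restrict)
  then have "bip_minors d A B \<psi> = 0"
    by (simp add: bip_minors_def minors_def mult_ac)
  then have "(\<Prod>P\<in>bipartitions n. bipartition_minors n d P \<psi>) = 0"
    using AB by (intro prod_zero) (auto simp: bipartition_minors_pair[OF AB] intro!: bexI[of _ "{A, B}"])
  then show ?thesis by (simp add: gmean_minors_def)
qed

lemma bip_minors_zero_tensor:
  assumes \<psi>: "pure_state d (A \<union> B) \<psi>" and AB: "A \<inter> B = {}" and fin: "finite A" "finite B"
    and zero: "bip_minors d A B \<psi> = 0"
  obtains \<phi> \<eta> where "pure_state d A \<phi>" "pure_state d B \<eta>" "\<psi> = tensor d A B \<phi> \<eta>"
proof -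
  let ?X = "basis d A" and ?Z = "basis d B"
  define g where "g x z = \<psi> (merge A B (x, z))" for x z
  have norm: "(\<Sum>x\<in>?X. \<Sum>z\<in>?Z. (cmod (g x z))\<^sup>2) = 1"
    unfolding g_def by (rule pure_state_merge_norm[OF \<psi> AB])
  have "\<exists>x\<in>?X. \<exists>z\<in>?Z. g x z \<noteq> 0"
  proof (rule ccontr)
    assume "\<not> ?thesis"
    then show False using norm by simp
  qed
  then obtain x0 z0 where x0: "x0 \<in> ?X" "z0 \<in> ?Z" "g x0 z0 \<noteq> 0" by blast
  have "(\<Sum>x\<in>?X. \<Sum>y\<in>?X. \<Sum>z\<in>?Z. \<Sum>w\<in>?Z. (cmod (g x z * g y w - g x w * g y z))\<^sup>2) = 0"
    using zero by (simp add: bip_minors_def minors_def g_def)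
  then have minor: "g x z * g y w = g x w * g y z"
    if "x \<in> ?X" "y \<in> ?X" "z \<in> ?Z" "w \<in> ?Z" for x y z w
    using that fin by (simp add: sum_nonneg_eq_0_iff sum_nonneg)
  define a where "a = (\<Sum>x\<in>?X. (cmod (g x z0))\<^sup>2)"
  have "(cmod (g x0 z0))\<^sup>2 \<le> a" unfolding a_def using fin x0 by (intro member_le_sum) auto
  then have a: "a > 0" using x0(3) by (smt (verit) zero_less_norm_iff zero_less_power)
  \<comment> \<open>Vanishing minors make the matrix the outer product of column \<open>z0\<close>
    and row \<open>x0\<close>, divided by the pivot \<open>g x0 z0\<close>. As \<open>sqrt a\<close>
    is the norm of that column, \<open>\<phi>\<close> is a unit vector, and then so is
    \<open>\<eta>\<close>, because \<open>\<psi>\<close> is.\<close>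
  define \<phi> where "\<phi> x = (if x \<in> ?X then g x z0 / of_real (sqrt a) else 0)" for x
  define \<eta> where "\<eta> z = (if z \<in> ?Z then g x0 z * of_real (sqrt a) / g x0 z0 else 0)" for z
  have g: "g x z = \<phi> x * \<eta> z" if "x \<in> ?X" "z \<in> ?Z" for x z
    using minor[OF that(1) x0(1) that(2) x0(2)] that x0 a
    by (simp add: \<phi>_def \<eta>_def field_simps)
  have n\<phi>: "(\<Sum>x\<in>?X. (cmod (\<phi> x))\<^sup>2) = 1"
    using a by (simp add: \<phi>_def norm_divide power_divide sum_divide_distrib[symmetric] a_def[symmetric])
  have "1 = (\<Sum>x\<in>?X. \<Sum>z\<in>?Z. (cmod (\<phi> x))\<^sup>2 * (cmod (\<eta> z))\<^sup>2)"
    unfolding norm[symmetric] by (intro sum.cong refl) (simp add: g norm_mult power_mult_distrib)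
  then have n\<eta>: "(\<Sum>z\<in>?Z. (cmod (\<eta> z))\<^sup>2) = 1"
    using n\<phi> by (simp add: sum_product[symmetric])
  have "\<psi> u = tensor d A B \<phi> \<eta> u" for u
  proof (cases "u \<in> basis d (A \<union> B)")
    case True
    then have "restrict u A \<in> ?X" "restrict u B \<in> ?Z" "merge A B (restrict u A, restrict u B) = u"
      by (auto simp: basis_def PiE_iff extensional_restrict)
    then have "\<psi> u = \<phi> (restrict u A) * \<eta> (restrict u B)"
      using g[of "restrict u A" "restrict u B"] unfolding g_def by simp
    then show ?thesis using True by (simp add: tensor_def)
  qed (use \<psi> in \<open>auto simp: tensor_def pure_state_def\<close>)
  then show ?thesis using that[of \<phi> \<eta>] n\<phi> n\<eta> by (auto simp: pure_state_def \<phi>_def \<eta>_def)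
qed

lemma gmean_minors_zero_biseparable_pure:
  assumes n: "n \<ge> 2" and \<psi>: "pure_state d {1..n} \<psi>" and zero: "gmean_minors n d \<psi> = 0"
  shows "biseparable_pure n d \<psi>"
proof -
  obtain P where P: "P \<in> bipartitions n" "bipartition_minors n d P \<psi> = 0"
    using zero by (auto simp: gmean_minors_def)
  define A where "A = (SOME A. A \<in> P)"
  define B where "B = {1..n} - A"
  have A: "A \<subseteq> {1..n}" "P = {A, B}" using bipartitions_SOME[OF P(1)] by (auto simp: A_def B_def)
  then have AB: "A \<union> B = {1..n}" "A \<inter> B = {}" "finite A" "finite B"
    by (auto simp: B_def intro: finite_subset)
  have "bip_minors d A B \<psi> = 0" using P(2) by (simp add: bipartition_minors_def A_def B_def Let_def)
  then obtain \<phi> \<eta> where "pure_state d A \<phi>" "pure_state d B \<eta>" "\<psi> = tensor d A B \<phi> \<eta>"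
    using bip_minors_zero_tensor[OF _ AB(2-4)] \<psi> AB(1) by metis
  then show ?thesis using P(1) A(2) unfolding biseparable_pure_def by blast
qed

lemma decomposes_zero_biseparable:
  assumes n: "n \<ge> 2" and dec: "decomposes n d \<rho> 0" and tr: "op_trace d {1..n} \<rho> = 1"
  shows "biseparable n d \<rho>"
proof -
  obtain m v where v: "decomposition n d \<rho> m v" "0 = (\<Sum>i<m. gmean_minors n d (v i))"
    using dec unfolding decomposes_def by blast
  obtain p \<psi> where r: "realizes d {1..n} \<rho> m p \<psi>" and z: "(\<Sum>i<m. p i * gmean_minors n d (\<psi> i)) = 0"
    using decomposition_realizes[OF n v(1) tr] v(2) by metis
  have p: "p i \<ge> 0" "pure_state d {1..n} (\<psi> i)" if "i < m" for i using r that by (auto simp: realizes_def)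
  have bs: "biseparable_pure n d (\<psi> i)" if "i < m" "p i \<noteq> 0" for i
  proof -
    have "p i * gmean_minors n d (\<psi> i) = 0"
      using z p that by (subst (asm) sum_nonneg_eq_0_iff) (auto simp: gmean_minors_nonneg)
    then show ?thesis using that p by (intro gmean_minors_zero_biseparable_pure[OF n]) auto
  qed
  have "(\<Sum>i<m. p i) \<noteq> 0" using r by (simp add: realizes_def)
  then obtain k where k: "k < m" "p k \<noteq> 0" by (metis lessThan_iff sum.neutral)
  \<comment> \<open>Terms of weight 0 may fail to be biseparable, yet \<open>biseparable\<close>
    constrains every term; they are replaced by a term of positive weight.\<close>
  define \<psi>' where "\<psi>' i = (if p i = 0 then \<psi> k else \<psi> i)" for i
  have "(\<lambda>x y. \<Sum>i<m. of_real (p i) * ket_bra (\<psi> i) x y) = (\<lambda>x y. \<Sum>i<m. of_real (p i) * ket_bra (\<psi>' i) x y)"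
    by (intro ext sum.cong) (auto simp: \<psi>'_def)
  then have "realizes d {1..n} \<rho> m p \<psi>'"
    using r k p by (auto simp: realizes_def \<psi>'_def)
  moreover have "biseparable_pure n d (\<psi>' i)" if "i < m" for i
    using bs that k by (simp add: \<psi>'_def)
  ultimately show ?thesis unfolding biseparable_def by blast
qed

section \<open>Monotonicity, vanishing and positivity\<close>

lemma gbc_locc_ensemble:
  assumes n: "n \<ge> 2" and d: "\<forall>i\<in>{1..n}. d i \<ge> 2"
    and \<rho>: "density_op d {1..n} \<rho>" and ens: "locc_ensemble n d \<rho> M p \<sigma>"
  shows "(\<Sum>m\<in>M. p m * gbc n d (\<sigma> m)) \<le> gbc n d \<rho>"
proof -
  obtain c where "decomposes n d \<rho> c" using density_op_decomposes[OF \<rho>] by blast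
  then obtain c0 where c0: "decomposes n d \<rho> c0" "gbc n d \<rho> = gbc_factor n d * c0"
    using gbc_eq_min_decomposes[OF n d] \<rho> by (metis density_op_def)
  obtain \<E> where locc: "locc {1..n} d d M \<E>" and \<sigma>: "\<And>m. m \<in> M \<Longrightarrow> density_op d {1..n} (\<sigma> m)"
    and \<E>: "\<And>m. m \<in> M \<Longrightarrow> \<E> m \<rho> = (\<lambda>x y. of_real (p m) * \<sigma> m x y)"
    using ens unfolding locc_ensemble_def by blast
  obtain c' where c': "\<And>m. m \<in> M \<Longrightarrow> decomposes n d (\<E> m \<rho>) (c' m)" "(\<Sum>m\<in>M. c' m) \<le> c0"
    using decomposes_locc[OF n locc c0(1)] by blast
  have "p m * gbc n d (\<sigma> m) \<le> gbc_factor n d * c' m" if m: "m \<in> M" for m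
  proof -
    have tr: "op_trace d {1..n} (\<sigma> m) = 1" using \<sigma>[OF m] by (simp add: density_op_def)
    obtain l v where "decomposition n d (\<E> m \<rho>) l v" using c'(1)[OF m] unfolding decomposes_def by blast
    \<comment> \<open>Traces identify \<open>p m\<close> with a sum of squared norms, so it is
      nonnegative although \<open>locc_ensemble\<close> does not demand this.\<close>
    from op_trace_decomposition[OF this]
    have "complex_of_real (p m) = of_real (\<Sum>i<l. \<Sum>x\<in>basis d {1..n}. (cmod (v i x))\<^sup>2)"
      using tr by (simp add: \<E>[OF m] op_trace_def flip: sum_distrib_left)
    then have "p m = (\<Sum>i<l. \<Sum>x\<in>basis d {1..n}. (cmod (v i x))\<^sup>2)" by (rule of_real_eq_iff[THEN iffD1])
    then have "p m \<ge> 0" by (simp add: sum_nonneg)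
    show ?thesis
    proof (cases "p m = 0")
      case True
      then show ?thesis using decomposes_nonneg[OF c'(1)[OF m]] gbc_factor_pos[OF d] by simp
    next
      case False
      then have pm: "p m > 0" using \<open>p m \<ge> 0\<close> by simp
      \<comment> \<open>Rescaling the decomposition of the unnormalised outcome gives one of
        \<open>\<sigma> m\<close>, whose cost bounds the minimum from above.\<close>
      have "(\<lambda>x y. of_real (1 / p m) * \<E> m \<rho> x y) = \<sigma> m"
        using pm by (simp add: \<E>[OF m])
      then have dec: "decomposes n d (\<sigma> m) (1 / p m * c' m)"
        using decomposes_scale[OF n c'(1)[OF m], of "1 / p m"] pm by simp
      obtain c1 where "c1 \<le> 1 / p m * c' m" "gbc n d (\<sigma> m) = gbc_factor n d * c1"
        using gbc_eq_min_decomposes[OF n d tr dec] dec by metis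
      then show ?thesis using pm gbc_factor_pos[OF d] by (simp add: field_simps)
    qed
  qed
  then have "(\<Sum>m\<in>M. p m * gbc n d (\<sigma> m)) \<le> (\<Sum>m\<in>M. gbc_factor n d * c' m)" by (rule sum_mono)
  also have "\<dots> \<le> gbc_factor n d * c0"
    using c'(2) gbc_factor_pos[OF d] by (simp flip: sum_distrib_left)
  finally show ?thesis by (simp add: c0(2))
qed

lemma gbc_biseparable:
  assumes n: "n \<ge> 2" and d: "\<forall>i\<in>{1..n}. d i \<ge> 2"
    and \<rho>: "density_op d {1..n} \<rho>" and bs: "biseparable n d \<rho>"
  shows "gbc n d \<rho> = 0"
proof -
  obtain m p \<psi> where r: "realizes d {1..n} \<rho> m p \<psi>" and "\<forall>i<m. biseparable_pure n d (\<psi> i)"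
    using bs unfolding biseparable_def by blast
  then have "(\<Sum>i<m. p i * gmean_minors n d (\<psi> i)) = 0" by (simp add: biseparable_pure_gmean_minors)
  then have dec: "decomposes n d \<rho> 0" using realizes_decomposes[OF n r] by simp
  have tr: "op_trace d {1..n} \<rho> = 1" using \<rho> by (simp add: density_op_def)
  obtain c0 where "decomposes n d \<rho> c0" "c0 \<le> 0" "gbc n d \<rho> = gbc_factor n d * c0"
    using gbc_eq_min_decomposes[OF n d tr dec] dec by metis
  then show ?thesis using decomposes_nonneg[of n d \<rho> c0] by simp
qed

text \<open>Because the minimum is attained, the value 0 would come from an actual decomposition of
  cost 0 and hence from a biseparable ensemble.\<close>

lemma gbc_genuinely_entangled:
  assumes n: "n \<ge> 2" and d: "\<forall>i\<in>{1..n}. d i \<ge> 2" and ge: "genuinely_entangled n d \<rho>"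
  shows "gbc n d \<rho> > 0"
proof -
  have \<rho>: "density_op d {1..n} \<rho>" "\<not> biseparable n d \<rho>" using ge by (auto simp: genuinely_entangled_def)
  then have tr: "op_trace d {1..n} \<rho> = 1" by (simp add: density_op_def)
  obtain c where "decomposes n d \<rho> c" using density_op_decomposes[OF \<rho>(1)] by blast
  then obtain c0 where c0: "decomposes n d \<rho> c0" "gbc n d \<rho> = gbc_factor n d * c0"
    using gbc_eq_min_decomposes[OF n d tr] by metis
  then have "c0 \<noteq> 0" using decomposes_zero_biseparable[OF n _ tr] \<rho>(2) by blast
  then have "c0 > 0" using decomposes_nonneg[OF c0(1)] by simp
  then show ?thesis using c0(2) gbc_factor_pos[OF d] by simp
qed

theorem theorem1:
  fixes n :: nat and d :: "nat \<Rightarrow> nat"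
  assumes "n \<ge> 2" and "\<forall>i\<in>{1..n}. d i \<ge> 2"
  shows "(\<forall>\<rho> M p \<sigma>. density_op d {1..n} \<rho> \<longrightarrow> locc_ensemble n d \<rho> M p \<sigma> \<longrightarrow>
            gbc n d \<rho> \<ge> (\<Sum>m\<in>M. p m * gbc n d (\<sigma> m)))
       \<and> (\<forall>\<rho>. density_op d {1..n} \<rho> \<longrightarrow> biseparable n d \<rho> \<longrightarrow> gbc n d \<rho> = 0)
       \<and> (\<forall>\<rho>. genuinely_entangled n d \<rho> \<longrightarrow> gbc n d \<rho> > 0)"
  using gbc_locc_ensemble[OF assms] gbc_biseparable[OF assms] gbc_genuinely_entangled[OF assms]
  by blast

end
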